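(* The spiral conjecture is true when $V$ is one dimensional. Explicitly: let $V$ be a one-dimensional vector space over $\mathbb{C}$, let $R_1,\dots,R_n$ be linear subspaces of $V\times V$, and suppose that the relation $R=\bigcup_{i=1}^n R_i$ on $V$ is symmetric. Then every relation avoiding origin path $p$ (with respect to $R$) is weakly homotopic to a relation avoiding origin path $q$ for which there exist linearly independent vectors $x_1,\dots,x_k$ in $V$ and complex numbers $a_1,\dots,a_k$ such that $$q(t)=\sum_{j=1}^k x_j\cdot e^{a_j t}\quad\text{for all } t\in[0,\infty).$$
   Context: Let $V$ be a finite-dimensional vector space over $\mathbb{C}$ (with its standard topology), let $R_1,\dots,R_n$ ($n\ge 1$) be linear relations, i.e. complex linear subspaces of $V\times V$, and let $R=\bigcup_{i=1}^n R_i$. Write $aRb$ if $(a,b)\in R$. It is assumed that $R$ is symmetric: $aRb\iff bRa$. A relation avoiding origin path (for $R$) is a continuous function $p:[0,\infty)\to V$ with $\lim_{t\to\infty}p(t)=0$ such that there do not exist times $t_1,t_2\in[0,\infty)$ (possibly equal) with $p(t_1)\,R\,p(t_2)$. Two relation avoiding origin paths $p$ and $q$ are weakly homotopic if there exists a continuous function $h:[0,1]\times[0,\infty)\to V$ such that: 1) $\lim_{t\to\infty}h(s,t)=0$ for all $s$; 2) $h(0,t)=p(t)$ for all $t$; 3) $h(1,t)=q(t)$ for all $t$; 4) there does not exist any $(s,t)\in[0,1]\times[0,\infty)$ with $h(s,t)\,R\,h(s,0)$. *)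

theory Defs
  imports "HOL-Analysis.Analysis"
begin

text \<open>
  A complex vector space with a Hausdorff vector space topology. On a finite-dimensional space
  there is exactly one such topology, so together with a finite-dimensionality assumption this
  locale says that the space carries its standard topology.
\<close>

locale complex_hausdorff_tvs = vector_space scl
  for scl :: "complex \<Rightarrow> 'v::{topological_ab_group_add, t2_space} \<Rightarrow> 'v" +
  assumes continuous_on_scl: "continuous_on UNIV (\<lambda>(c, v). scl c v)"

definition linear_relation ::
  "(complex \<Rightarrow> 'v::ab_group_add \<Rightarrow> 'v) \<Rightarrow> ('v \<times> 'v) set \<Rightarrow> bool"
  where "linear_relation scl S \<longleftrightarrow> module.subspace (module_prod.scale scl scl) S"

text \<open>
  Functions on \<open>[0, \<infinity>)\<close> are represented by functions on all reals, whose
  values at negative arguments are irrelevant.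
\<close>

definition relation_avoiding_origin_path ::
  "('v \<times> 'v) set \<Rightarrow> (real \<Rightarrow> 'v::{topological_space, zero}) \<Rightarrow> bool"
  where "relation_avoiding_origin_path R p \<longleftrightarrow>
    continuous_on {0..} p \<and>
    (p \<longlongrightarrow> 0) at_top \<and>
    \<not> (\<exists>t1\<in>{0..}. \<exists>t2\<in>{0..}. (p t1, p t2) \<in> R)"

definition weakly_homotopic ::
  "('v \<times> 'v) set \<Rightarrow> (real \<Rightarrow> 'v::{topological_space, zero}) \<Rightarrow> (real \<Rightarrow> 'v) \<Rightarrow> bool"
  where "weakly_homotopic R p q \<longleftrightarrow>
    (\<exists>h :: real \<Rightarrow> real \<Rightarrow> 'v.
      continuous_on ({0..1} \<times> {0..}) (\<lambda>(s, t). h s t) \<and>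
      (\<forall>s\<in>{0..1}. (h s \<longlongrightarrow> 0) at_top) \<and>
      (\<forall>t\<in>{0..}. h 0 t = p t) \<and>
      (\<forall>t\<in>{0..}. h 1 t = q t) \<and>
      \<not> (\<exists>s\<in>{0..1}. \<exists>t\<in>{0..}. (h s t, h s 0) \<in> R))"

end

theory Submission
  imports Defs "HOL-Complex_Analysis.Riemann_Mapping"
begin

text \<open>
  Writing \<open>p = exp \<circ> f\<close> in a coordinate of \<open>V\<close>, the path avoids \<open>R\<close> iff no difference
  \<open>f t - f s\<close> lies in the preimage \<open>L\<close> under \<open>exp\<close> of a finite set of ratios; \<open>L\<close> lies on finitely
  many vertical lines, its columns. A weak homotopy has to keep \<open>f t - f 0\<close> outside \<open>L\<close>, and the
  required path is a straight ray.

  For \<open>c \<le> Re (f 0)\<close> let \<open>height c\<close> be the imaginary part of \<open>f\<close> at its last visit to the line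
  \<open>Re z = c\<close>. For \<open>l \<in> L\<close> to the left of \<open>0\<close>, the sign of \<open>height (c + Re l) - height c - Im l\<close> does
  not depend on \<open>c\<close> and says on which side of \<open>l\<close> the path passes. Integrating over \<open>c\<close> shows that
  these finitely many conditions are compatible with a common slope, so some ray passes every
  point of \<open>L\<close> on the same side as the path.

  After restarting the path at its last visit to the initial line, it stays in the left half plane.
  Cut it at the last visits to the columns. Between two such times it is homotopic outside \<open>L\<close> to
  the corresponding piece of the ray, because both lie in a plane domain whose complement, made of
  translates of the path and horizontal rays, has only unbounded components. Left of all columns a
  straight-line homotopy suffices.
\<close>

section \<open>Last crossings\<close>

locale decaying_path =
  fixes f :: "real \<Rightarrow> complex"
  assumes cont: "continuous_on {0..} f"
    and Re_at_bot: "filterlim (\<lambda>t. Re (f t)) at_bot at_top"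
begin

text \<open>The half plane \<open>c \<le> Re z\<close> replaces the line \<open>Re z = c\<close>:
  for \<open>c \<le> Re (f 0)\<close> the set of times then contains \<open>0\<close>, and the
  supremum is attained.\<close>

definition last_time :: "real \<Rightarrow> real" where
  "last_time c = Sup {t. 0 \<le> t \<and> c \<le> Re (f t)}"

definition height :: "real \<Rightarrow> real" where
  "height c = Im (f (last_time c))"

lemma eventually_left:
  obtains N where "N \<ge> 0" "\<And>t. t \<ge> N \<Longrightarrow> Re (f t) < c"
proof -
  have "eventually (\<lambda>t. Re (f t) < c) at_top"
    using Re_at_bot by (simp add: filterlim_at_bot_dense)
  then obtain N where "\<And>t. t \<ge> N \<Longrightarrow> Re (f t) < c"
    by (auto simp: eventually_at_top_linorder)
  then show thesis
    by (intro that[of "max N 0"]) auto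
qed

lemma continuous_on_Re_f: "continuous_on {0..} (\<lambda>t. Re (f t))"
  and continuous_on_Im_f: "continuous_on {0..} (\<lambda>t. Im (f t))"
  using cont by (auto intro!: continuous_intros)

lemma bdd_above_times: "bdd_above {t. 0 \<le> t \<and> c \<le> Re (f t)}"
proof -
  obtain N where "\<And>t. t \<ge> N \<Longrightarrow> Re (f t) < c"
    using eventually_left by blast
  then show ?thesis
    by (intro bdd_aboveI[of _ N]) (metis linorder_not_le mem_Collect_eq nle_le)
qed

lemma closed_times: "closed {t. 0 \<le> t \<and> c \<le> Re (f t)}"
proof -
  have "closed ((\<lambda>t. Re (f t)) -` {c..} \<inter> {0..})"
    using continuous_on_Re_f continuous_on_closed_vimage[of "{0..}" "\<lambda>t. Re (f t)"] by simp
  moreover have "(\<lambda>t. Re (f t)) -` {c..} \<inter> {0..} = {t. 0 \<le> t \<and> c \<le> Re (f t)}"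
    by auto
  ultimately show ?thesis by simp
qed

lemma Re_after_last_time: "Re (f t) < c" if "last_time c < t" "0 \<le> t"
proof (rule ccontr)
  assume "\<not> ?thesis"
  then have "t \<le> last_time c"
    using that unfolding last_time_def by (intro cSup_upper bdd_above_times) auto
  with that show False by simp
qed

context
  fixes c
  assumes c: "c \<le> Re (f 0)"
begin

lemma last_time_nonneg: "0 \<le> last_time c"
  and Re_last_time_ge: "c \<le> Re (f (last_time c))"
proof -
  have "last_time c \<in> {t. 0 \<le> t \<and> c \<le> Re (f t)}"
    unfolding last_time_def
    using c by (intro closed_contains_Sup closed_times bdd_above_times) auto
  then show "0 \<le> last_time c" "c \<le> Re (f (last_time c))" by auto
qed

text \<open>The path ends up left of \<open>c\<close>, so by the intermediate value theorem a value
  above \<open>c\<close> at this time would force a later visit to the line.\<close>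

lemma Re_last_time [simp]: "Re (f (last_time c)) = c"
proof (rule antisym)
  show "Re (f (last_time c)) \<le> c"
  proof (rule ccontr)
    assume *: "\<not> ?thesis"
    obtain N where N: "N \<ge> 0" "\<And>t. t \<ge> N \<Longrightarrow> Re (f t) < c"
      using eventually_left by blast
    have less: "last_time c < N"
      using N(2)[of "last_time c"] * by linarith
    have "continuous_on {last_time c..N} (\<lambda>t. Re (f t))"
      using last_time_nonneg by (intro continuous_on_subset[OF continuous_on_Re_f]) auto
    then obtain t where "last_time c \<le> t" "t \<le> N" "Re (f t) = c"
      using IVT2'[of "\<lambda>t. Re (f t)" N c "last_time c"] N(2)[of N] less * by force
    with * Re_after_last_time[of c t] last_time_nonneg show False
      by (cases "t = last_time c") auto
  qed
qed (rule Re_last_time_ge)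

lemma f_last_time: "f (last_time c) = Complex c (height c)"
  by (simp add: complex_eq_iff height_def)

lemma Re_after_last_time_le: "Re (f t) \<le> c" if "last_time c \<le> t"
  using Re_after_last_time[of c t] that last_time_nonneg by (cases "t = last_time c") auto

end

lemma last_time_antimono: "last_time d \<le> last_time c" if "c \<le> d" "d \<le> Re (f 0)"
proof (rule ccontr)
  assume "\<not> ?thesis"
  then have "Re (f (last_time d)) < c"
    using Re_after_last_time[of c "last_time d"] last_time_nonneg[of d] that by simp
  with that show False by simp
qed

lemma last_time_strict: "last_time d < last_time c" if "c < d" "d \<le> Re (f 0)"
  using last_time_antimono[of c d] Re_last_time[of c] Re_last_time[of d] that
  by (cases "last_time d = last_time c") auto

end

section \<open>The side on which a path passes a forbidden difference\<close>

text \<open>\<open>g - Ln \<circ> F\<close> is continuous with values in the multiples of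
  \<open>2 * pi * \<i>\<close>, hence constant on a connected set. The increment of any continuous
  logarithm can thus be read off from endpoint values.\<close>

lemma continuous_log_diff_eq_Ln_diff:
  assumes "connected S" "continuous_on S g" "continuous_on S F"
    and "\<And>x. x \<in> S \<Longrightarrow> exp (g x) = F x" "\<And>x. x \<in> S \<Longrightarrow> F x \<notin> \<real>\<^sub>\<le>\<^sub>0"
    and "x \<in> S" "y \<in> S"
  shows "g x - g y = Ln (F x) - Ln (F y)"
proof -
  have nz: "F x \<noteq> 0" if "x \<in> S" for x
    using assms(4)[OF that] by (metis exp_not_eq_zero)
  define k where "k = (\<lambda>x. g x - Ln (F x))"
  have k1: "exp (k x) = 1" if "x \<in> S" for x
    using assms(4)[OF that] nz[OF that] by (simp add: k_def exp_diff)
  have "k constant_on S"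
  proof (rule continuous_discrete_range_constant[OF assms(1)])
    show "continuous_on S k"
      unfolding k_def using assms by (intro continuous_intros) auto
    fix x assume x: "x \<in> S"
    show "\<exists>e>0. \<forall>y. y \<in> S \<and> k y \<noteq> k x \<longrightarrow> e \<le> norm (k y - k x)"
    proof (intro exI[of _ "2 * pi"] conjI allI impI; (elim conjE)?)
      fix y assume y: "y \<in> S" "k y \<noteq> k x"
      then have "exp (k y - k x) = 1"
        using k1 x by (simp add: exp_diff)
      then obtain n :: int where n: "Re (k y - k x) = 0" "Im (k y - k x) = of_int (2 * n) * pi"
        by (auto simp: exp_eq_1)
      with y have "n \<noteq> 0"
        by (auto simp: complex_eq_iff)
      then have "1 \<le> \<bar>real_of_int n\<bar>"
        by linarith
      then have "2 * pi \<le> \<bar>Im (k y - k x)\<bar>"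
        unfolding n by (simp add: abs_mult)
      then show "2 * pi \<le> norm (k y - k x)"
        using abs_Im_le_cmod order_trans by blast
    qed auto
  qed
  then show ?thesis
    using assms(6,7) by (auto simp: constant_on_def k_def algebra_simps)
qed

locale avoiding_path = decaying_path +
  fixes L :: "complex set"
  assumes avoids: "\<lbrakk>0 \<le> s; 0 \<le> t\<rbrakk> \<Longrightarrow> f t - f s \<notin> L"
begin

text \<open>
  The difference \<open>f t - f s - l\<close> has a logarithm on the whole quadrant. Two last crossings can be
  joined through points \<open>(s, t)\<close> with \<open>s\<close> bounded and \<open>t\<close> large, where the difference stays in the
  left half plane, and also with the roles of \<open>s\<close> and \<open>t\<close> exchanged, where it stays in the right
  half plane. If the sign changed, the increments of the argument along these two routes would be
  opposite.
\<close>

lemma side_invariant_aux: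
  assumes l: "l \<in> L" "Re l \<le> 0"
    and c: "c \<le> Re (f 0)" and d: "d \<le> Re (f 0)"
    and above: "height (c + Re l) - height c > Im l"
    and below: "height (d + Re l) - height d < Im l"
  shows False
proof -
  define F where "F = (\<lambda>(s, t). f t - f s - l)"
  define Q where "Q = {0::real..} \<times> {0::real..}"
  have contF: "continuous_on Q F"
    unfolding F_def Q_def case_prod_unfold
    by (intro continuous_intros continuous_on_compose2[OF cont]) auto
  have F0: "F z \<noteq> 0" if "z \<in> Q" for z
    using that avoids[of "fst z" "snd z"] l by (auto simp: F_def Q_def case_prod_unfold)
  have "contractible Q"
    unfolding Q_def by (intro convex_imp_contractible convex_Times convex_real_interval)
  then obtain g where contg: "continuous_on Q g" and g: "\<And>z. z \<in> Q \<Longrightarrow> F z = exp (g z)"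
    using continuous_logarithm_on_contractible[OF contF] F0 by metis
  have c': "c + Re l \<le> Re (f 0)" and d': "d + Re l \<le> Re (f 0)"
    using c d l by auto
  define sc tc sd td where "sc = last_time c" "tc = last_time (c + Re l)"
    "sd = last_time d" "td = last_time (d + Re l)"
  note defs = sc_tc_sd_td_def
  have nonneg: "sc \<ge> 0" "tc \<ge> 0" "sd \<ge> 0" "td \<ge> 0"
    unfolding defs using last_time_nonneg c d c' d' by auto
  have Fc: "F (sc, tc) = Complex 0 (height (c + Re l) - height c - Im l)"
    unfolding F_def defs using c c' by (simp add: complex_eq_iff height_def)
  have Fd: "F (sd, td) = Complex 0 (height (d + Re l) - height d - Im l)"
    unfolding F_def defs using d d' by (simp add: complex_eq_iff height_def)
  \<comment> \<open>\<open>m\<close> bounds \<open>Re f\<close> from below up to all four crossing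
    times, and at time \<open>N\<close> the path is left of \<open>m + Re l\<close>. This fixes the
    sign of the real part on the middle piece of each route.\<close>
  have "bounded ((\<lambda>t. Re (f t)) ` {0..max (max sc sd) (max tc td)})"
    by (intro compact_imp_bounded compact_continuous_image
        continuous_on_subset[OF continuous_on_Re_f]) auto
  then obtain m where m: "\<And>t. 0 \<le> t \<Longrightarrow> t \<le> max (max sc sd) (max tc td) \<Longrightarrow> m \<le> Re (f t)"
    unfolding bounded_iff by (metis abs_le_D2 atLeastAtMost_iff imageI minus_le_iff real_norm_def)
  obtain N0 where N0: "N0 \<ge> 0" "\<And>t. t \<ge> N0 \<Longrightarrow> Re (f t) < m + Re l"
    using eventually_left by blast
  define N where "N = max N0 (max (max sc sd) (max tc td))"
  have N: "N \<ge> sc" "N \<ge> tc" "N \<ge> sd" "N \<ge> td" "Re (f N) < m + Re l"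
    using N0(2)[of N] by (auto simp: N_def)
  define S1 where "S1 = ({sc} \<times> {tc..N} \<union> closed_segment sc sd \<times> {N}) \<union> {sd} \<times> {td..N}"
  define S2 where "S2 = ({sc..N} \<times> {tc} \<union> {N} \<times> closed_segment tc td) \<union> {sd..N} \<times> {td}"
  have conn_seg: "connected (closed_segment a b)" for a b :: real
    by (intro convex_connected convex_closed_segment)
  have "(sc, N) \<in> {sc} \<times> {tc..N} \<inter> closed_segment sc sd \<times> {N}"
    "(sd, N) \<in> ({sc} \<times> {tc..N} \<union> closed_segment sc sd \<times> {N}) \<inter> {sd} \<times> {td..N}"
    "(N, tc) \<in> {sc..N} \<times> {tc} \<inter> {N} \<times> closed_segment tc td"
    "(N, td) \<in> ({sc..N} \<times> {tc} \<union> {N} \<times> closed_segment tc td) \<inter> {sd..N} \<times> {td}"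
    using N by auto
  then have conn: "connected S1" "connected S2"
    unfolding S1_def S2_def
    by (blast intro!: connected_Un connected_Times connected_Icc connected_sing conn_seg)+
  have sub: "S1 \<subseteq> Q" "S2 \<subseteq> Q"
    unfolding S1_def S2_def Q_def using nonneg N by (auto simp: closed_segment_eq_real_ivl split: if_splits)
  have m': "m \<le> Re (f t)" if "t \<in> closed_segment sc sd \<or> t \<in> closed_segment tc td" for t
    using that nonneg by (intro m) (auto simp: closed_segment_eq_real_ivl split: if_splits)
  have Re1: "Re (F z) \<le> 0" if "z \<in> S1" for z
    using that unfolding S1_def
  proof (elim UnE)
    assume "z \<in> {sc} \<times> {tc..N}"
    then obtain t where "z = (sc, t)" "tc \<le> t" by auto
    then show ?thesis
      using Re_after_last_time_le[OF c', of t] c by (simp add: F_def defs)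
  next
    assume "z \<in> {sd} \<times> {td..N}"
    then obtain t where "z = (sd, t)" "td \<le> t" by auto
    then show ?thesis
      using Re_after_last_time_le[OF d', of t] d by (simp add: F_def defs)
  next
    assume "z \<in> closed_segment sc sd \<times> {N}"
    then obtain s where s: "z = (s, N)" "s \<in> closed_segment sc sd" by auto
    then show ?thesis
      using m'[of s] N by (simp add: F_def)
  qed
  have Re2: "Re (F z) \<ge> 0" if "z \<in> S2" for z
    using that unfolding S2_def
  proof (elim UnE)
    assume "z \<in> {sc..N} \<times> {tc}"
    then obtain t where "z = (t, tc)" "sc \<le> t" by auto
    then show ?thesis
      using Re_after_last_time_le[OF c, of t] c' by (simp add: F_def defs)
  next
    assume "z \<in> {sd..N} \<times> {td}"
    then obtain t where "z = (t, td)" "sd \<le> t" by auto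
    then show ?thesis
      using Re_after_last_time_le[OF d, of t] d' by (simp add: F_def defs)
  next
    \<comment> \<open>The real part is at least \<open>- 2 * Re l\<close> here, which is where
      \<open>Re l \<le> 0\<close> enters.\<close>
    assume "z \<in> {N} \<times> closed_segment tc td"
    then obtain s where s: "z = (N, s)" "s \<in> closed_segment tc td" by auto
    then show ?thesis
      using m'[of s] N l by (simp add: F_def)
  qed
  have in_S: "(sc, tc) \<in> S1" "(sd, td) \<in> S1" "(sc, tc) \<in> S2" "(sd, td) \<in> S2"
    unfolding S1_def S2_def using N by auto
  \<comment> \<open>On \<open>S1\<close> the values of \<open>F\<close> are nonzero with real part
    at most \<open>0\<close>, so \<open>- F\<close> avoids the slit of \<open>Ln\<close>; adding
    \<open>\<i> * pi\<close> turns \<open>g\<close> into a logarithm of \<open>- F\<close>.\<close>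
  have "(g (sc, tc) + \<i> * pi) - (g (sd, td) + \<i> * pi) = Ln (- F (sc, tc)) - Ln (- F (sd, td))"
  proof (rule continuous_log_diff_eq_Ln_diff[of S1 "\<lambda>z. g z + \<i> * pi" "\<lambda>z. - F z"])
    fix z assume "z \<in> S1"
    then have "z \<in> Q" using sub by auto
    then show "exp (g z + \<i> * pi) = - F z"
      using g by (simp add: exp_add)
    show "- F z \<notin> \<real>\<^sub>\<le>\<^sub>0"
      using Re1[OF \<open>z \<in> S1\<close>] F0[OF \<open>z \<in> Q\<close>] by (auto simp: complex_nonpos_Reals_iff complex_eq_iff)
  qed (use conn in_S sub contg contF continuous_on_subset in \<open>auto intro!: continuous_intros\<close>)
  moreover have "g (sc, tc) - g (sd, td) = Ln (F (sc, tc)) - Ln (F (sd, td))"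
  proof (rule continuous_log_diff_eq_Ln_diff[of S2])
    fix z assume "z \<in> S2"
    then have "z \<in> Q" using sub by auto
    then show "exp (g z) = F z"
      using g by simp
    show "F z \<notin> \<real>\<^sub>\<le>\<^sub>0"
      using Re2[OF \<open>z \<in> S2\<close>] F0[OF \<open>z \<in> Q\<close>] by (auto simp: complex_nonpos_Reals_iff complex_eq_iff)
  qed (use conn in_S sub contg contF continuous_on_subset in \<open>auto intro!: continuous_intros\<close>)
  \<comment> \<open>All four endpoint values are purely imaginary. The increment of
    \<open>Im g\<close> from the \<open>d\<close>-end to the \<open>c\<close>-end comes out as
    \<open>- pi\<close> along \<open>S1\<close> and as \<open>pi\<close> along
    \<open>S2\<close>.\<close>
  moreover have "Im (Ln (Complex 0 y)) = (if y > 0 then pi/2 else - pi/2)" if "y \<noteq> 0" for y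
    using that Im_Ln_eq[of "Complex 0 y"] by (auto simp: complex_eq_iff)
  moreover have "- Complex 0 y = Complex 0 (- y)" for y
    by (simp add: complex_eq_iff)
  ultimately show False
    using above below unfolding Fc Fd by (simp add: complex_eq_iff)
qed

lemma height_diff_neq:
  assumes "l \<in> L" "Re l \<le> 0" "c \<le> Re (f 0)"
  shows "height (c + Re l) - height c \<noteq> Im l"
proof
  assume "height (c + Re l) - height c = Im l"
  then have "f (last_time (c + Re l)) - f (last_time c) = l"
    using assms by (simp add: f_last_time complex_eq_iff)
  with avoids[of "last_time c" "last_time (c + Re l)"] last_time_nonneg assms show False
    by simp
qed

definition passes_above :: "complex \<Rightarrow> bool" where
  "passes_above l \<longleftrightarrow> height (Re (f 0) + Re l) - height (Re (f 0)) > Im l"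

text \<open>A strict change of sign between two lines is excluded by
  \<open>side_invariant_aux\<close>, in either direction, and the value zero by
  \<open>height_diff_neq\<close>.\<close>

lemma passes_above_iff:
  assumes "l \<in> L" "Re l \<le> 0" "c \<le> Re (f 0)"
  shows "passes_above l \<longleftrightarrow> height (c + Re l) - height c > Im l"
  using assms side_invariant_aux[of l c "Re (f 0)"] side_invariant_aux[of l "Re (f 0)" c]
    height_diff_neq[of l c] height_diff_neq[of l "Re (f 0)"]
  unfolding passes_above_def by (meson linorder_neqE_linordered_idom order_refl)

end

section \<open>A common slope\<close>

text \<open>The interval has positive measure, so strict positivity survives integration. No
  continuity is assumed, because \<open>height\<close> may jump.\<close>

lemma integral_strict_pos:
  fixes g :: "real \<Rightarrow> real"
  assumes g: "g absolutely_integrable_on {a..b}" and "a < b" and pos: "\<And>x. x \<in> {a..b} \<Longrightarrow> g x > 0"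
  shows "integral {a..b} g > 0"
proof -
  interpret finite_measure "lebesgue_on {a..b}"
    by (simp add: finite_measure_lebesgue_on)
  have int: "integrable (lebesgue_on {a..b}) g"
    using g by (simp add: integrable_restrict_space set_integrable_def)
  have "integral\<^sup>L (lebesgue_on {a..b}) (\<lambda>_. 0) < integral\<^sup>L (lebesgue_on {a..b}) g"
    using \<open>a < b\<close> pos by (intro integral_less_AE_space int AE_I2) (auto simp: emeasure_restrict_space)
  then show ?thesis
    using lebesgue_integral_eq_integral[OF int] by simp
qed

text \<open>In general only \<open>Sup A \<le> Inf B\<close> would follow. Local finiteness makes
  both extrema attained inside \<open>{a0..b0}\<close>, which leaves a genuine gap.\<close>

lemma exists_between_locally_finite:
  fixes A B :: "real set"
  assumes "A \<noteq> {}" "B \<noteq> {}" "\<And>a b. a \<in> A \<Longrightarrow> b \<in> B \<Longrightarrow> a < b"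
    and "\<And>u v. finite ((A \<union> B) \<inter> {u..v})"
  obtains s where "\<And>a. a \<in> A \<Longrightarrow> a < s" "\<And>b. b \<in> B \<Longrightarrow> s < b"
proof -
  obtain a0 b0 where ab: "a0 \<in> A" "b0 \<in> B"
    using assms(1,2) by auto
  define A' B' where "A' = A \<inter> {a0..b0}" and "B' = B \<inter> {a0..b0}"
  have fin: "finite A'" "finite B'"
    unfolding A'_def B'_def by (rule finite_subset[OF _ assms(4)[of a0 b0]]; blast)+
  have mem: "a0 \<in> A'" "b0 \<in> B'"
    unfolding A'_def B'_def using ab assms(3)[of a0 b0] by auto
  have max: "Max A' \<in> A'" "Min B' \<in> B'"
    using fin mem by (metis Max_in Min_in empty_iff)+
  then obtain s where s: "Max A' < s" "s < Min B'"
    using assms(3)[of "Max A'" "Min B'"] dense by (auto simp: A'_def B'_def)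
  show thesis
  proof (rule that[of s])
    fix a assume a: "a \<in> A"
    show "a < s"
    proof (cases "a \<in> A'")
      case True
      then show ?thesis using Max_ge[OF fin(1)] s by fastforce
    next
      case False
      then have "a < a0" using a assms(3)[of a b0] ab by (auto simp: A'_def)
      then show ?thesis using Max_ge[OF fin(1) mem(1)] s by simp
    qed
  next
    fix b assume b: "b \<in> B"
    show "s < b"
    proof (cases "b \<in> B'")
      case True
      then show ?thesis using Min_le[OF fin(2)] s by fastforce
    next
      case False
      then have "b0 < b" using b assms(3)[of a0 b] ab by (auto simp: B'_def)
      then show ?thesis using Min_le[OF fin(2) mem(2)] s by simp
    qed
  qed
qed

section \<open>Integrability of the last-crossing height\<close>

context decaying_path
begin

text \<open>\<open>last_time\<close> is monotone, hence Borel, and \<open>Im \<circ> f\<close> is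
  continuous; over a bounded interval the crossing times stay in a compact set, so the composition
  is bounded.\<close>

lemma height_absolutely_integrable:
  assumes "b \<le> Re (f 0)"
  shows "height absolutely_integrable_on {a..b}"
proof -
  \<comment> \<open>Monotonicity is known only up to \<open>Re (f 0)\<close>; truncating at
    \<open>b\<close> makes it global. Likewise \<open>max t 0\<close> below extends
    \<open>Im \<circ> f\<close> continuously to all reals.\<close>
  define T where "T = (\<lambda>c. last_time (min c b))"
  have "mono (\<lambda>c. - T c)"
    unfolding T_def using assms by (intro monoI) (auto intro!: last_time_antimono)
  then have T[measurable]: "T \<in> borel_measurable borel"
    using borel_measurable_mono[of "\<lambda>c. - T c"] by simp
  define I where "I = (\<lambda>t. Im (f (max t 0)))"
  have "continuous_on UNIV I"
    unfolding I_def by (intro continuous_intros continuous_on_compose2[OF cont]) auto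
  then have [measurable]: "I \<in> borel_measurable borel"
    by (rule borel_measurable_continuous_onI)
  have "(\<lambda>c. I (T c)) \<in> borel_measurable lborel"
    by measurable
  then have meas: "(\<lambda>c. I (T c)) \<in> borel_measurable lebesgue"
    by (rule measurable_completion)
  have eq: "I (T c) = height c" if "c \<in> {a..b}" for c
    using that assms last_time_nonneg[of c] by (simp add: I_def T_def height_def)
  define N where "N = last_time (min a b)"
  have "bounded ((\<lambda>t. Im (f t)) ` {0..N})"
    by (intro compact_imp_bounded compact_continuous_image
        continuous_on_subset[OF continuous_on_Im_f]) auto
  then obtain B where B: "\<And>t. t \<in> {0..N} \<Longrightarrow> \<bar>Im (f t)\<bar> \<le> B"
    unfolding bounded_iff by (metis imageI real_norm_def)
  have bound: "norm (I (T c)) \<le> B" if "c \<in> {a..b}" for c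
    using that assms last_time_nonneg[of c] last_time_antimono[of a c] B[of "last_time c"]
    by (simp add: eq height_def N_def)
  have "(\<lambda>c. I (T c)) absolutely_integrable_on {a..b}"
    by (rule measurable_bounded_by_integrable_imp_absolutely_integrable[where g = "\<lambda>_. B"])
      (use bound in \<open>auto intro!: measurable_restrict_space1 meas\<close>)
  moreover have "(\<lambda>c. I (T c)) absolutely_integrable_on {a..b} \<longleftrightarrow> height absolutely_integrable_on {a..b}"
    by (rule set_integrable_cong) (simp_all add: eq)
  ultimately show ?thesis
    by simp
qed

end

section \<open>Comparison of slopes\<close>

context avoiding_path
begin

text \<open>
  Over an interval of length \<open>y\<close>, the integral of \<open>height (c - x) - height c\<close> is a mixed second
  difference of a primitive of \<open>height\<close>, hence symmetric in \<open>x\<close> and \<open>y\<close>.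
\<close>

lemma slope_less:
  assumes l: "l \<in> L" "Re l < 0" "passes_above l"
    and k: "k \<in> L" "Re k < 0" "\<not> passes_above k"
  shows "Im l / (- Re l) < Im k / (- Re k)"
proof -
  define a x y where "a = Re (f 0)" and "x = - Re l" and "y = - Re k"
  have xy: "x > 0" "y > 0"
    using l k by (auto simp: x_def y_def)
  have ai: "height absolutely_integrable_on {u..v}" if "v \<le> a" for u v
    using that height_absolutely_integrable by (simp add: a_def)
  have int: "height integrable_on {u..v}" if "v \<le> a" for u v
    using ai[OF that] set_lebesgue_integral_eq_integral(1) by blast
  have shift: "(\<lambda>c. height (c - z)) absolutely_integrable_on {u..v}" if "v \<le> a" "z > 0" for u v z
    using ai[of "v - z" "u - z"] that integrable_shift_real_ivl_iff[of height "- z" "u - z" "v - z"]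
      integrable_shift_real_ivl_iff[of "\<lambda>c. norm (height c)" "- z" "u - z" "v - z"]
    unfolding absolutely_integrable_on_def by simp
  have shift_int: "integral {u..v} (\<lambda>c. height (c - z)) = integral {u - z..v - z} height" for u v z
    using integral_shift_real_ivl[of "u - z" "-z" "v - z" height] by simp
  have above: "height (c - x) - height c > Im l" if "c \<le> a" for c
    using passes_above_iff[of l c] l that by (simp add: x_def a_def)
  have below: "height (c - y) - height c < Im k" if "c \<le> a" for c
    using passes_above_iff[of k c] height_diff_neq[of k c] k that by (simp add: y_def a_def)
  have comm: "a - y - x = a - x - y"
    by simp
  \<comment> \<open>The window lengths are crossed: the inequality for \<open>l\<close> is
    integrated over length \<open>- Re k\<close>, the one for \<open>k\<close> over length
    \<open>- Re l\<close>.\<close>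
  have "integral {a - y..a} (\<lambda>c. height (c - x) - height c - Im l) > 0"
    using xy above by (intro integral_strict_pos set_integral_diff shift ai) auto
  also have "integral {a - y..a} (\<lambda>c. height (c - x) - height c - Im l) =
      integral {a - y - x..a - x} height - integral {a - y..a} height - y * Im l"
    using xy shift[of a x "a - y"] int by (simp add: integral_diff integrable_diff
      set_lebesgue_integral_eq_integral(1) shift_int)
  finally have 1: "integral {a - x - y..a - x} height - integral {a - y..a} height > y * Im l"
    unfolding comm by simp
  have "integral {a - x..a} (\<lambda>c. Im k - (height (c - y) - height c)) > 0"
    using xy below by (intro integral_strict_pos set_integral_diff shift ai) auto
  also have "integral {a - x..a} (\<lambda>c. Im k - (height (c - y) - height c)) =
      x * Im k - (integral {a - x - y..a - y} height - integral {a - x..a} height)"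
    using xy shift[of a y "a - x"] int by (simp add: integral_diff integrable_diff
      set_lebesgue_integral_eq_integral(1) shift_int)
  finally have 2: "integral {a - x - y..a - y} height - integral {a - x..a} height < x * Im k"
    by simp
  \<comment> \<open>Both sides are the integral over \<open>{a - x - y..a}\<close>, split at
    \<open>a - y\<close> and at \<open>a - x\<close>. This identifies the second differences bounded
    in \<open>1\<close> and \<open>2\<close>.\<close>
  have "integral {a - x - y..a - y} height + integral {a - y..a} height =
      integral {a - x - y..a - x} height + integral {a - x..a} height"
    using xy Henstock_Kurzweil_Integration.integral_combine[of "a - x - y" "a - y" a height]
      Henstock_Kurzweil_Integration.integral_combine[of "a - x - y" "a - x" a height]
    by (simp add: int)
  with 1 2 have "y * Im l < x * Im k"
    by (simp add: algebra_simps)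
  then show ?thesis
    using xy by (simp add: x_def y_def field_simps)
qed

end

section \<open>Homotopies outside closed sets with unbounded components\<close>

text \<open>The frontier of a component of \<open>- S\<close> is nonempty and lies in
  \<open>K\<close>, so that component contains a whole component of \<open>K\<close> and is
  unbounded. In the plane this characterizes simple connectivity of the connected open set
  \<open>S\<close>.\<close>

lemma simply_connected_component_complement:
  fixes K :: "complex set"
  assumes "closed K" and unbounded: "\<And>C. C \<in> components K \<Longrightarrow> \<not> bounded C"
    and S: "S \<in> components (- K)"
  shows "simply_connected S"
proof -
  have "open S"
    using S \<open>closed K\<close> open_components by blast
  have "connected S" "S \<noteq> {}"
    using S in_components_connected in_components_nonempty by auto
  have "K \<subseteq> - S"
    using S in_components_subset by blast
  have "\<not> bounded C" if C: "C \<in> components (- S)" for C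
  proof -
    have "closed C"
      using C \<open>open S\<close> closed_components by blast
    then have "frontier C \<subseteq> C"
      by (simp add: frontier_subset_eq)
    moreover have "frontier C \<subseteq> K"
      using frontier_of_components_subset[OF C] S \<open>closed K\<close>
      by (metis frontier_complement frontier_of_components_closed_complement subset_trans)
    moreover have "frontier C \<noteq> {}"
      using in_components_nonempty[OF C] in_components_subset[OF C] \<open>S \<noteq> {}\<close>
      by (auto simp: frontier_eq_empty)
    ultimately obtain z where z: "z \<in> C" "z \<in> K"
      by blast
    then have "connected_component_set K z \<subseteq> C"
      using C \<open>K \<subseteq> - S\<close>
      by (intro components_maximal[OF C])
        (auto simp: connected_component_subset intro: connected_component_refl
          dest: connected_component_in)
    moreover have "\<not> bounded (connected_component_set K z)"
      using z by (intro unbounded componentsI)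
    ultimately show ?thesis
      using bounded_subset by blast
  qed
  then show ?thesis
    using simply_connected_eq_unbounded_complement_components[OF \<open>open S\<close>] \<open>connected S\<close> by blast
qed

text \<open>Along a convergent sequence the real parts of the sums and of the points of
  \<open>L\<close> are bounded, so the times are bounded too. A subsequence of times converges, and
  then so do the corresponding points of \<open>L\<close>.\<close>

lemma closed_translates:
  fixes g :: "real \<Rightarrow> complex"
  assumes g: "continuous_on {0..} g" "filterlim (\<lambda>t. Re (g t)) at_infinity at_top"
    and L: "closed L" "bounded (Re ` L)"
  shows "closed {g t + l |t l. 0 \<le> t \<and> l \<in> L}"
  unfolding closed_sequential_limits
proof (intro allI impI; elim conjE)
  fix Z z assume Z: "\<forall>n. Z n \<in> {g t + l |t l. 0 \<le> t \<and> l \<in> L}" "Z \<longlonglongrightarrow> z"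
  then have "\<exists>t l. Z n = g t + l \<and> 0 \<le> t \<and> l \<in> L" for n
    by blast
  then obtain t l where tl: "\<And>n. Z n = g (t n) + l n" "\<And>n. 0 \<le> t n" "\<And>n. l n \<in> L"
    by metis
  have "(\<lambda>n. Re (Z n)) \<longlonglongrightarrow> Re z"
    using Z by (intro tendsto_intros)
  then have "Bseq (\<lambda>n. Re (Z n))"
    by (intro convergent_imp_Bseq) (auto simp: convergent_def)
  then obtain B where B: "\<And>n. \<bar>Re (Z n)\<bar> \<le> B"
    by (auto simp: Bseq_def)
  obtain b where b: "\<And>l. l \<in> L \<Longrightarrow> \<bar>Re l\<bar> \<le> b"
    using L by (auto simp: bounded_iff)
  have "eventually (\<lambda>t. B + b + 1 \<le> norm (Re (g t))) at_top"
    using g(2) by (auto simp: filterlim_at_infinity[of "B + b"] filterlim_at_infinity_conv_norm_at_top filterlim_at_top)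
  then obtain N where N: "\<And>t. t \<ge> N \<Longrightarrow> B + b + 1 \<le> \<bar>Re (g t)\<bar>"
    by (auto simp: eventually_at_top_linorder)
  have "t n \<le> N" for n
  proof (rule ccontr)
    assume "\<not> ?thesis"
    then show False
      using N[of "t n"] B[of n] b[OF tl(3)[of n]] tl(1)[of n] by (auto simp: abs_if split: if_splits)
  qed
  then have "\<forall>n. t n \<in> {0..N}"
    using tl by auto
  then obtain t' r where t': "t' \<in> {0..N}" "strict_mono r" "(t \<circ> r) \<longlonglongrightarrow> t'"
    using compact_imp_seq_compact[OF compact_Icc] seq_compactE by metis
  have "(\<lambda>n. g ((t \<circ> r) n)) \<longlonglongrightarrow> g t'"
    using t' tl by (intro continuous_on_tendsto_compose[OF g(1)]) (auto simp: comp_def)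
  moreover have "(Z \<circ> r) \<longlonglongrightarrow> z"
    using Z t' LIMSEQ_subseq_LIMSEQ by blast
  ultimately have "(\<lambda>n. (Z \<circ> r) n - g ((t \<circ> r) n)) \<longlonglongrightarrow> z - g t'"
    by (rule tendsto_diff[rotated])
  moreover have "(\<lambda>n. (Z \<circ> r) n - g ((t \<circ> r) n)) = l \<circ> r"
    using tl by (auto simp: comp_def)
  ultimately have "z - g t' \<in> L"
    using \<open>closed L\<close> tl(3) unfolding closed_sequential_limits
    by (metis comp_apply)
  then show "z \<in> {g t + l |t l. 0 \<le> t \<and> l \<in> L}"
    using t' by (auto intro!: exI[of _ t'] exI[of _ "z - g t'"])
qed

text \<open>The component contains the entire translated curve \<open>g + l\<close> through
  \<open>z\<close>, whose real part is unbounded.\<close>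

lemma unbounded_component_translates:
  fixes g :: "real \<Rightarrow> complex"
  assumes g: "continuous_on {0..} g" "filterlim (\<lambda>t. Re (g t)) at_infinity at_top"
    and sub: "{g t + l |t l. 0 \<le> t \<and> l \<in> L} \<subseteq> K" and C: "C \<in> components K"
    and z: "z \<in> C" "z \<in> {g t + l |t l. 0 \<le> t \<and> l \<in> L}"
  shows "\<not> bounded C"
proof
  assume bdd: "bounded C"
  obtain t l where tl: "z = g t + l" "0 \<le> t" "l \<in> L"
    using z by blast
  have "connected ((\<lambda>t. g t + l) ` {0..})"
    by (intro connected_continuous_image continuous_intros g convex_connected) auto
  then have "(\<lambda>t. g t + l) ` {0..} \<subseteq> C"
    by (rule components_maximal[OF C]) (use sub tl z in auto)
  then obtain b where b: "\<And>t. t \<ge> 0 \<Longrightarrow> norm (g t + l) \<le> b"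
    using bdd by (auto simp: bounded_iff)
  have "eventually (\<lambda>t. norm (Re (g t)) \<ge> b + norm l + 1) at_top"
    using g(2) by (auto simp: filterlim_at_infinity_conv_norm_at_top filterlim_at_top)
  then have "eventually (\<lambda>t. norm (Re (g t)) \<ge> b + norm l + 1 \<and> t \<ge> 0) at_top"
    using eventually_ge_at_top by (rule eventually_conj)
  then obtain t where "norm (Re (g t)) \<ge> b + norm l + 1" "t \<ge> 0"
    by (auto simp: eventually_at_top_linorder)
  moreover have "norm (Re (g t)) \<le> norm (g t)"
    using abs_Re_le_cmod by simp
  moreover have "norm (g t) \<le> norm (g t + l) + norm l"
    by (metis add_diff_cancel_right' norm_triangle_ineq4)
  ultimately show False
    using b[of t] by linarith
qed

text \<open>Sharing their starting point, both paths run in one component of \<open>- K\<close>,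
  which is simply connected.\<close>

lemma homotopic_paths_in_component:
  fixes K :: "complex set"
  assumes "closed K" "\<And>C. C \<in> components K \<Longrightarrow> \<not> bounded C"
    and p: "path p" "path_image p \<inter> K = {}" and q: "path q" "path_image q \<inter> K = {}"
    and "pathstart p = pathstart q" "pathfinish p = pathfinish q"
  shows "homotopic_paths (- K) p q"
proof -
  define S where "S = connected_component_set (- K) (pathstart p)"
  have "pathstart p \<in> - K"
    using p(2) pathstart_in_path_image[of p] by blast
  then have "S \<in> components (- K)"
    unfolding S_def by (rule componentsI)
  then have "simply_connected S"
    using assms(1,2) by (intro simply_connected_component_complement[of K S])
  moreover have "path_image p \<subseteq> S" "path_image q \<subseteq> S"
    unfolding S_def using assms pathstart_in_path_image[of p] pathstart_in_path_image[of q]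
    by (intro connected_component_maximal connected_path_image; auto)+
  ultimately have "homotopic_paths S p q"
    using assms by (metis simply_connected_eq_homotopic_paths)
  then show ?thesis
    by (rule homotopic_paths_subset) (simp add: S_def connected_component_subset)
qed

text \<open>Used to cancel the vertical segment that is traversed back and forth when two
  consecutive strips are glued.\<close>

lemma homotopic_paths_cancel_middle:
  fixes S :: "'a::real_normed_vector set"
  assumes p: "path p" "path_image p \<subseteq> S" and q: "path q" "path_image q \<subseteq> S"
    and r: "path r" "path_image r \<subseteq> S"
    and "pathfinish p = pathstart q" "pathstart q = pathstart r"
  shows "homotopic_paths S ((p +++ q) +++ (reversepath q +++ r)) (p +++ r)"
proof -
  have "homotopic_paths S ((p +++ q) +++ (reversepath q +++ r)) (p +++ (q +++ (reversepath q +++ r)))"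
    using assms by (intro homotopic_paths_sym[OF homotopic_paths_assoc]) (auto simp: path_image_join)
  also have "homotopic_paths S \<dots> (p +++ ((q +++ reversepath q) +++ r))"
    using assms by (intro homotopic_paths_join homotopic_paths_assoc) (auto simp: path_image_join)
  also have "homotopic_paths S \<dots> (p +++ (linepath (pathstart r) (pathstart r) +++ r))"
    using assms homotopic_paths_rinv[OF q] by (intro homotopic_paths_join) auto
  also have "homotopic_paths S \<dots> (p +++ r)"
    using assms by (intro homotopic_paths_join homotopic_paths_lid) auto
  finally show ?thesis .
qed

lemma homotopic_paths_linepath_join:
  fixes a b c :: "'a::real_normed_vector"
  assumes "b \<in> closed_segment a c" "closed_segment a c \<subseteq> S"
  shows "homotopic_paths S (linepath a b +++ linepath b c) (linepath a c)"
proof (rule homotopic_paths_subset)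
  have "path_image (linepath a b +++ linepath b c) \<subseteq> closed_segment a c"
    using assms(1) by (auto simp: path_image_join subset_closed_segment)
  then show "homotopic_paths (closed_segment a c) (linepath a b +++ linepath b c) (linepath a c)"
    using convex_imp_simply_connected[OF convex_closed_segment, of a c]
    unfolding simply_connected_eq_homotopic_paths by auto
qed (rule assms)

section \<open>Straightening a path in the left half plane\<close>

text \<open>The ray with direction \<open>Complex (- 1) \<sigma>\<close> meets the column of
  \<open>l\<close> at height \<open>\<sigma> * (- Re l)\<close>, so \<open>slope\<close> says that
  it passes every such \<open>l\<close> on the same side as the path.\<close>

locale normalized_avoiding_path = avoiding_path +
  fixes \<sigma> :: real
  assumes start: "f 0 = 0" and Re_neg: "\<And>t. 0 < t \<Longrightarrow> Re (f t) < 0"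
    and closed_L: "closed L" and finite_Re: "finite (Re ` L)"
    and slope: "\<And>l. \<lbrakk>l \<in> L; Re l < 0\<rbrakk> \<Longrightarrow>
      if passes_above l then Im l < \<sigma> * (- Re l) else \<sigma> * (- Re l) < Im l"
begin

definition ray :: "real \<Rightarrow> complex" where
  "ray x = of_real x * Complex (- 1) \<sigma>"

text \<open>Indexed by the distance to the left, so that \<open>f (T x)\<close> and
  \<open>ray x\<close> lie on the same vertical line.\<close>

abbreviation T :: "real \<Rightarrow> real" where
  "T x \<equiv> last_time (- x)"

lemma ray_simps [simp]: "ray 0 = 0" "Re (ray x) = - x" "Im (ray x) = \<sigma> * x"
  by (simp_all add: ray_def)

lemma f_notin: "f t \<notin> L" if "0 \<le> t"
  using avoids[of 0 t] that start by simp

lemma zero_notin: "0 \<notin> L"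
  using avoids[of 0 0] by simp

lemma last_time_0 [simp]: "last_time 0 = 0"
proof -
  have "0 \<le> last_time 0" "Re (f (last_time 0)) = 0"
    using start last_time_nonneg Re_last_time by simp_all
  then show ?thesis
    using Re_neg[of "last_time 0"] by linarith
qed

lemma T_nonneg: "0 \<le> T x" and Re_T [simp]: "Re (f (T x)) = - x" if "0 \<le> x"
  using that start last_time_nonneg Re_last_time by simp_all

lemma T_strict_mono: "T x < T y" if "0 \<le> x" "x < y"
  using that start last_time_strict[of "- y" "- x"] by simp

lemma ray_notin: "ray x \<notin> L" if "0 \<le> x"
  using that zero_notin slope[of "ray x"] by (cases "x = 0") (auto split: if_splits)

lemma segment_ray: "closed_segment (ray x) (ray y) = ray ` {x..y}" if "x \<le> y"
proof -
  have "closed_segment (ray x) (ray y) = (\<lambda>r. of_real r * Complex (- 1) \<sigma>) ` closed_segment x y"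
    unfolding ray_def
    by (rule closed_segment_linear_image[where f = "\<lambda>r. of_real r * Complex (- 1) \<sigma>"])
      (auto intro!: linearI simp: algebra_simps scaleR_conv_of_real)
  then show ?thesis
    using that by (simp add: closed_segment_eq_real_ivl ray_def)
qed

lemma segment_ray_disjoint: "closed_segment (ray x) (ray y) \<inter> L = {}" if "0 \<le> x" "x \<le> y"
  using that ray_notin by (auto simp: segment_ray)

lemma Re_vertical_segment: "Re z = - x" if z: "z \<in> closed_segment (ray x) (f (T x))" "0 \<le> x"
proof -
  obtain u where "z = (1 - u) *\<^sub>R ray x + u *\<^sub>R f (T x)"
    using z(1) unfolding closed_segment_def by blast
  then have "Re z = (1 - u) * (- x) + u * (- x)"
    using z(2) by simp
  then show ?thesis
    by (simp add: algebra_simps)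
qed

text \<open>Both endpoints lie strictly on the same side of every point of \<open>L\<close> in their
  column: the ray by \<open>slope\<close>, the path by the meaning of \<open>passes_above\<close>,
  since \<open>height 0 = 0\<close>.\<close>

lemma vertical_segment_disjoint: "closed_segment (ray x) (f (T x)) \<inter> L = {}" if "0 \<le> x"
proof (cases "x = 0")
  case True
  then show ?thesis using zero_notin start by simp
next
  case False
  have False if l: "l \<in> closed_segment (ray x) (f (T x))" "l \<in> L" for l
  proof -
    have Re: "Re l = - x"
      using l(1) \<open>0 \<le> x\<close> by (rule Re_vertical_segment)
    have "Im l \<in> closed_segment (\<sigma> * x) (height (- x))"
      using closed_segment_linear_image[of Im "ray x" "f (T x)"] l(1)
      by (auto simp: height_def bounded_linear.linear bounded_linear_Im)
    moreover have "passes_above l \<longleftrightarrow> height (- x) > Im l"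
      using Re start by (simp add: passes_above_def height_def)
    moreover have "height (- x) \<noteq> Im l"
      using f_notin[of "T x"] l Re T_nonneg[of x] \<open>0 \<le> x\<close> by (metis Re_T complex_eqI height_def)
    ultimately show False
      using slope[OF l(2)] Re \<open>0 \<le> x\<close> False
      by (auto simp: closed_segment_eq_real_ivl split: if_splits)
  qed
  then show ?thesis by blast
qed

lemma path_subpath_f: "path (subpath a b f)" if "0 \<le> a" "a \<le> b"
  unfolding path_def subpath_def
proof (intro continuous_intros continuous_on_compose2[OF cont] image_subsetI)
  fix u :: real assume "u \<in> {0..1}"
  with that show "(b - a) * u + a \<in> {0..}" by simp
qed

lemma path_image_subpath_f: "path_image (subpath a b f) = f ` {a..b}" if "0 \<le> a" "a \<le> b"
  using that by (simp add: path_image_subpath)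

text \<open>Rescaling \<open>{0..c}\<close> to the unit interval turns all three pieces into
  subpaths of the single path \<open>g\<close>.\<close>

lemma homotopic_join_subpaths_f:
  assumes "0 \<le> a" "a \<le> b" "b \<le> c" "0 < c"
  shows "homotopic_paths (- L) (subpath a b f +++ subpath b c f) (subpath a c f)"
proof -
  define g where "g = subpath 0 c f"
  have sub: "subpath u v f = subpath (u / c) (v / c) g" for u v
  proof
    fix r
    have "c * ((v / c - u / c) * r + u / c) = (v - u) * r + u"
      using \<open>0 < c\<close> by (simp add: algebra_simps)
    then show "subpath u v f r = subpath (u / c) (v / c) g r"
      by (simp add: subpath_def g_def)
  qed
  have "path g" "path_image g \<subseteq> - L"
    unfolding g_def using assms f_notin by (auto simp: path_subpath_f path_image_subpath_f)
  then show ?thesis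
    unfolding sub using assms by (intro homotopic_join_subpaths) auto
qed

text \<open>
  Between two consecutive columns of \<open>L\<close>, the translates \<open>f + l\<close> by the points of the columns to
  the left together with horizontal rays from the points to the right form a closed set whose
  components are unbounded. It misses the path by the avoidance hypothesis, and a path within the
  closed strip meets it only in \<open>L\<close>.
\<close>

lemma homotopic_strip:
  assumes x: "0 \<le> x" "x < y" and gap: "\<And>l. l \<in> L \<Longrightarrow> \<not> (- y < Re l \<and> Re l < - x)"
  shows "homotopic_paths (- L) (subpath (T x) (T y) f)
    (linepath (f (T x)) (ray x) +++ (linepath (ray x) (ray y) +++ linepath (ray y) (f (T y))))"
    (is "homotopic_paths _ ?p ?q")
proof -
  \<comment> \<open>The gap makes \<open>L1\<close> and \<open>L2\<close> cover \<open>L\<close>.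
    Horizontal rays are translates of the curve \<open>of_real\<close>, so the same two lemmas on
    translates serve both halves of \<open>K\<close>.\<close>
  define L1 L2 where "L1 = L \<inter> {l. Re l \<le> - y}" and "L2 = L \<inter> {l. - x \<le> Re l}"
  define K1 K2 where "K1 = {f t + l |t l. 0 \<le> t \<and> l \<in> L1}"
    and "K2 = {of_real t + l |t l. 0 \<le> t \<and> l \<in> L2}"
  define K where "K = K1 \<union> K2"
  have lim: "filterlim (\<lambda>t. Re (f t)) at_infinity at_top"
      "filterlim (\<lambda>t. Re (of_real t :: complex)) at_infinity at_top"
    using Re_at_bot filterlim_at_bot_imp_at_infinity
    by (auto intro: filterlim_at_top_imp_at_infinity filterlim_ident)
  have cont': "continuous_on {0..} (of_real :: real \<Rightarrow> complex)"
    by (intro continuous_intros)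
  have closed: "closed L1" "closed L2"
    unfolding L1_def L2_def using closed_L
    by (auto intro!: closed_Int closed_halfspace_Re_le closed_halfspace_Re_ge)
  have bdd: "bounded (Re ` L1)" "bounded (Re ` L2)"
    unfolding L1_def L2_def using finite_Re
    by (auto intro!: finite_imp_bounded intro: finite_subset)
  have "closed K"
    unfolding K_def K1_def K2_def
    by (intro closed_Un closed_translates lim cont cont' closed bdd)
  have unbdd: "\<not> bounded C" if C: "C \<in> components K" for C
  proof -
    obtain z where "z \<in> C" "z \<in> K"
      using in_components_nonempty[OF C] in_components_subset[OF C] by blast
    then show ?thesis
      using unbounded_component_translates[OF cont lim(1) _ C, of L1]
        unbounded_component_translates[OF cont' lim(2) _ C, of L2]
      unfolding K_def K1_def K2_def by blast
  qed
  \<comment> \<open>At positive times the points of \<open>K1\<close> lie strictly left of the strip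
    and those of \<open>K2\<close> strictly right of it; only \<open>t = 0\<close> remains.\<close>
  have strip: "z \<in> L" if "z \<in> K" "- y \<le> Re z" "Re z \<le> - x" for z
    using that(1) unfolding K_def
  proof
    assume "z \<in> K1"
    then obtain t l where tl: "z = f t + l" "0 \<le> t" "l \<in> L" "Re l \<le> - y"
      by (auto simp: K1_def L1_def)
    then have "t = 0"
      using that(2) Re_neg[of t] by fastforce
    then show ?thesis using tl start by simp
  next
    assume "z \<in> K2"
    then obtain t l where tl: "z = of_real t + l" "0 \<le> t" "l \<in> L" "- x \<le> Re l"
      by (auto simp: K2_def L2_def)
    then have "t = 0"
      using that(3) by simp
    then show ?thesis using tl by simp
  qed
  have "L \<subseteq> K"
  proof
    fix l assume l: "l \<in> L"
    show "l \<in> K"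
    proof (cases "Re l \<le> - y")
      case True
      then have "l = f 0 + l" "l \<in> L1" using l start by (auto simp: L1_def)
      then show ?thesis unfolding K_def K1_def by blast
    next
      case False
      then have "l = of_real 0 + l" "l \<in> L2" using l gap[OF l] by (auto simp: L2_def)
      then show ?thesis unfolding K_def K2_def by blast
    qed
  qed
  have T: "0 \<le> T x" "T x \<le> T y"
    using T_strict_mono[of x y] T_nonneg x by auto
  have "homotopic_paths (- K) ?p ?q"
  proof (rule homotopic_paths_in_component[OF \<open>closed K\<close> unbdd])
    show "path ?p" using T by (simp add: path_subpath_f)
    show "path_image ?p \<inter> K = {}"
    proof -
      \<comment> \<open>The path may leave the strip to the left and return before
        \<open>T y\<close>, so \<open>strip\<close> does not suffice: \<open>K1\<close> is excluded
        by avoidance, and \<open>K2\<close> because the path stays left of \<open>- x\<close> after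
        \<open>T x\<close>.\<close>
      have False if t: "T x \<le> t" "f t \<in> K" for t
      proof -
        have "0 \<le> t" using t T by simp
        have "f t \<notin> K1"
        proof
          assume "f t \<in> K1"
          then obtain s l where "f t - f s = l" "0 \<le> s" "l \<in> L"
            by (auto simp: K1_def L1_def)
          then show False using avoids \<open>0 \<le> t\<close> by blast
        qed
        then obtain s l where sl: "f t = of_real s + l" "0 \<le> s" "l \<in> L" "- x \<le> Re l"
          using t by (auto simp: K_def K2_def L2_def)
        moreover have "Re (f t) \<le> - x"
          using Re_after_last_time_le[of "- x" t] x t start by simp
        ultimately have "s = 0" by simp
        then show False using sl f_notin[OF \<open>0 \<le> t\<close>] by simp
      qed
      then show ?thesis using T by (auto simp: path_image_subpath_f)
    qed
    show "path_image ?q \<inter> K = {}"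
    proof -
      have "path_image ?q = closed_segment (ray x) (f (T x)) \<union>
          (closed_segment (ray x) (ray y) \<union> closed_segment (ray y) (f (T y)))"
        by (simp add: path_image_join closed_segment_commute)
      moreover have "closed_segment (ray x) (f (T x)) \<inter> K = {}"
        using strip vertical_segment_disjoint[of x] x by (fastforce dest: Re_vertical_segment)
      moreover have "closed_segment (ray y) (f (T y)) \<inter> K = {}"
        using strip vertical_segment_disjoint[of y] x by (fastforce dest: Re_vertical_segment)
      moreover have "closed_segment (ray x) (ray y) \<inter> K = {}"
      proof -
        have "ray r \<notin> K" if "x \<le> r" "r \<le> y" for r
          using strip[of "ray r"] ray_notin[of r] that x by auto
        then show ?thesis
          using x by (auto simp: segment_ray)
      qed
      ultimately show ?thesis by blast
    qed
  qed auto
  then show ?thesis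
    by (rule homotopic_paths_subset) (use \<open>L \<subseteq> K\<close> in blast)
qed

text \<open>Append the homotopy for the strip: the vertical segment at \<open>x\<close> cancels
  against its reverse, and the two pieces of the ray merge.\<close>

lemma homotopic_step:
  assumes x: "0 \<le> x" "x < y" and gap: "\<And>l. l \<in> L \<Longrightarrow> \<not> (- y < Re l \<and> Re l < - x)"
    and hom: "homotopic_paths (- L) (subpath 0 (T x) f) (linepath 0 (ray x) +++ linepath (ray x) (f (T x)))"
  shows "homotopic_paths (- L) (subpath 0 (T y) f) (linepath 0 (ray y) +++ linepath (ray y) (f (T y)))"
proof -
  have T: "0 \<le> T x" "T x < T y"
    using T_strict_mono[of x y] T_nonneg x by auto
  have sub: "path_image (linepath 0 (ray x)) \<subseteq> - L" "path_image (linepath (ray x) (ray y)) \<subseteq> - L"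
    "path_image (linepath (ray x) (f (T x))) \<subseteq> - L" "path_image (linepath (ray y) (f (T y))) \<subseteq> - L"
    using segment_ray_disjoint[of 0 x] segment_ray_disjoint[of x y]
      vertical_segment_disjoint[of x] vertical_segment_disjoint[of y] x
    by (auto simp del: ray_simps(2,3))
  have "homotopic_paths (- L) (subpath 0 (T y) f) (subpath 0 (T x) f +++ subpath (T x) (T y) f)"
    using T by (intro homotopic_paths_sym[OF homotopic_join_subpaths_f]) auto
  also have "homotopic_paths (- L) \<dots> ((linepath 0 (ray x) +++ linepath (ray x) (f (T x))) +++
      (reversepath (linepath (ray x) (f (T x))) +++ (linepath (ray x) (ray y) +++ linepath (ray y) (f (T y)))))"
    using homotopic_strip[OF x gap] by (intro homotopic_paths_join hom) (simp_all add: reversepath_linepath)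
  also have "homotopic_paths (- L) \<dots>
      (linepath 0 (ray x) +++ (linepath (ray x) (ray y) +++ linepath (ray y) (f (T y))))"
    using sub by (intro homotopic_paths_cancel_middle) (auto simp: path_image_join)
  also have "homotopic_paths (- L) \<dots>
      ((linepath 0 (ray x) +++ linepath (ray x) (ray y)) +++ linepath (ray y) (f (T y)))"
    using sub by (intro homotopic_paths_assoc) auto
  also have "homotopic_paths (- L) \<dots> (linepath 0 (ray y) +++ linepath (ray y) (f (T y)))"
  proof (intro homotopic_paths_join homotopic_paths_linepath_join)
    show "ray x \<in> closed_segment 0 (ray y)" "closed_segment 0 (ray y) \<subseteq> - L"
      using segment_ray[of 0 y] ray_notin x by auto
  qed (use sub in auto)
  finally show ?thesis .
qed

text \<open>Induction on the number of columns strictly between \<open>- y\<close> and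
  \<open>0\<close>; each column is crossed by one application of
  \<open>homotopic_step\<close>.\<close>

lemma homotopic_prefix:
  assumes "0 \<le> y"
  shows "homotopic_paths (- L) (subpath 0 (T y) f) (linepath 0 (ray y) +++ linepath (ray y) (f (T y)))"
  using assms
proof (induction "card {r \<in> Re ` L. - y < r \<and> r < 0}" arbitrary: y rule: less_induct)
  case less
  have fin: "finite {r \<in> Re ` L. - z < r \<and> r < 0}" for z
    using finite_Re by simp
  have base: "homotopic_paths (- L) (subpath 0 (T 0) f) (linepath 0 (ray 0) +++ linepath (ray 0) (f (T 0)))"
  proof -
    have "subpath 0 (T 0) f = linepath 0 0" "linepath 0 (ray 0) +++ linepath (ray 0) (f (T 0)) = linepath 0 0"
      by (auto simp: subpath_def linepath_def joinpaths_def fun_eq_iff start)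
    then show ?thesis using zero_notin by simp
  qed
  show ?case
  proof (cases "{r \<in> Re ` L. - y < r \<and> r < 0} = {}")
    case True
    then show ?thesis
      using homotopic_step[of 0 y, OF _ _ _ base] base less.prems by (cases "y = 0") auto
  next
    case False
    \<comment> \<open>The leftmost column in the range: no column lies strictly between
      \<open>- y\<close> and \<open>r\<close>, and fewer remain to the right of
      \<open>r\<close>.\<close>
    define r where "r = Min {r \<in> Re ` L. - y < r \<and> r < 0}"
    have r: "r \<in> Re ` L" "- y < r" "r < 0"
      using Min_in[OF fin False] by (auto simp: r_def)
    have gap: "\<not> (- y < Re l \<and> Re l < r)" if "l \<in> L" for l
      using Min_le[OF fin, of "Re l" y] that r(3) by (force simp: r_def)
    have "{s \<in> Re ` L. - (- r) < s \<and> s < 0} \<subset> {r \<in> Re ` L. - y < r \<and> r < 0}"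
      using r by auto
    then have "card {s \<in> Re ` L. - (- r) < s \<and> s < 0} < card {r \<in> Re ` L. - y < r \<and> r < 0}"
      by (rule psubset_card_mono[OF fin])
    from less.hyps[OF this] show ?thesis
      using r gap by (intro homotopic_step[of "- r" y]) auto
  qed
qed

text \<open>First the part up to the last visit to a line left of all columns is deformed, the tail
  staying fixed. Then a straight-line homotopy leads to \<open>a * of_real t\<close>: up to
  \<open>N / 2\<close> the two paths agree, and afterwards both are left of
  \<open>L\<close>.\<close>

lemma ray_path_homotopy:
  obtains H :: "real \<Rightarrow> real \<Rightarrow> complex" and a :: complex
  where "continuous_on ({0..1} \<times> {0..}) (\<lambda>(s, t). H s t)"
    "\<And>s. s \<in> {0..1} \<Longrightarrow> filterlim (\<lambda>t. Re (H s t)) at_bot at_top"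
    "\<And>t. 0 \<le> t \<Longrightarrow> H 0 t = f t" "\<And>t. 0 \<le> t \<Longrightarrow> H 1 t = a * of_real t"
    "\<And>s. s \<in> {0..1} \<Longrightarrow> H s 0 = 0"
    "\<And>s t. s \<in> {0..1} \<Longrightarrow> 0 \<le> t \<Longrightarrow> H s t \<notin> L"
proof -
  obtain x where x: "x > 0" "\<And>l. l \<in> L \<Longrightarrow> - x < Re l"
  proof -
    obtain b where "\<And>l. l \<in> L \<Longrightarrow> \<bar>Re l\<bar> \<le> b"
      using finite_imp_bounded[OF finite_Re] by (auto simp: bounded_iff)
    then show thesis
      by (intro that[of "\<bar>b\<bar> + 1"]) (auto simp: abs_le_iff, smt (verit))
  qed
  define N where "N = T x"
  have N: "N > 0" "Re (f N) = - x"
    using T_strict_mono[of 0 x] x by (auto simp: N_def)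
  have after: "Re (f t) \<le> - x" if "N \<le> t" for t
    using Re_after_last_time_le[of "- x" t] that x start by (simp add: N_def)
  have hom: "homotopic_paths (- L) (subpath 0 N f) (linepath 0 (ray x) +++ linepath (ray x) (f N))"
    using homotopic_prefix[of x] x(1) by (simp add: N_def)
  obtain k :: "real \<times> real \<Rightarrow> complex" where k: "continuous_on ({0..1} \<times> {0..1}) k" "k \<in> {0..1} \<times> {0..1} \<rightarrow> - L"
    "\<forall>u\<in>{0..1}. k (0, u) = subpath 0 N f u"
    "\<forall>u\<in>{0..1}. k (1, u) = (linepath 0 (ray x) +++ linepath (ray x) (f N)) u"
    and ends: "\<forall>s\<in>{0..1}. pathstart (k \<circ> Pair s) = pathstart (subpath 0 N f) \<and>
      pathfinish (k \<circ> Pair s) = pathfinish (subpath 0 N f)"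
    using hom unfolding homotopic_paths by blast
  have k0: "k (s, 0) = 0" and k1: "k (s, 1) = f N" if "s \<in> {0..1}" for s
    using bspec[OF ends that] start by (simp_all add: pathstart_def pathfinish_def subpath_def)
  \<comment> \<open>The truncations glue \<open>k\<close> and \<open>f\<close> in one formula: for
    \<open>t \<le> N\<close> the bracket vanishes, and for \<open>t \<ge> N\<close> the first term
    is \<open>f N\<close>.\<close>
  define A where "A = (\<lambda>s t. k (s, min 1 (t / N)) + (f (max t N) - f N))"
  \<comment> \<open>The joined path covers the ray up to \<open>ray x\<close> in the first half of
    its time, that is, by \<open>N / 2\<close>. This is exactly the speed of that motion.\<close>
  define a where "a = 2 / of_real N * ray x"
  define H where "H = (\<lambda>s t. A (min 1 (2 * s)) t + of_real (max 0 (2 * s - 1)) * (a * of_real t - A 1 t))"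
  have "Re a < 0"
    using N x by (simp add: a_def)
  have a_t: "a * of_real t = ray (2 * x / N * t)" for t
    by (simp add: a_def ray_def)
  have A_early: "A s t = k (s, t / N)" if "t \<le> N" for s t
    using that N by (simp add: A_def max_def min_def)
  have A_late: "A s t = f t" if "s \<in> {0..1}" "N \<le> t" for s t
    using that N k1 by (simp add: A_def max_def min_def)
  have A_0: "A 0 t = f t" if "0 \<le> t" for t
    using that A_early[of t 0] A_late[of 0 t] N bspec[OF k(3), of "t / N"]
    by (cases "t \<le> N") (auto simp: subpath_def)
  have A_notin: "A s t \<notin> L" if "s \<in> {0..1}" "0 \<le> t" for s t
  proof (cases "t \<le> N")
    case True
    then have "k (s, t / N) \<in> - L"
      using that N by (intro funcset_mem[OF k(2)]) auto
    then show ?thesis using A_early True by simp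
  qed (use that A_late f_notin in auto)
  have A_1_early: "A 1 t = a * of_real t" if "0 \<le> t" "t \<le> N / 2" for t
    using that N bspec[OF k(4), of "t / N"]
    by (simp add: A_early joinpaths_def linepath_def a_t field_simps) (simp add: ray_def scaleR_conv_of_real)
  have A_1_late: "Re (A 1 t) \<le> - x" if "N / 2 \<le> t" for t
  proof (cases "t \<le> N")
    case True
    define u where "u = 2 * (t / N) - 1"
    have "k (1, t / N) = linepath (ray x) (f N) u"
      using bspec[OF k(4), of "t / N"] that True N
      by (cases "t = N / 2") (auto simp: u_def joinpaths_def linepath_def field_simps)
    then have "Re (A 1 t) = (1 - u) * (- x) + u * (- x)"
      using True N by (simp add: A_early linepath_def)
    then show ?thesis
      by (simp add: algebra_simps)
  qed (use A_late[of 1 t] after[of t] in auto)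
  show thesis
  proof
    have contA: "continuous_on ({0..1} \<times> {0..}) (\<lambda>(s, t). A s t)"
      unfolding A_def case_prod_unfold
      by (intro continuous_intros continuous_on_compose2[OF k(1)] continuous_on_compose2[OF cont])
        (use N in auto)
    show "continuous_on ({0..1} \<times> {0..}) (\<lambda>(s, t). H s t)"
    proof -
      have 1: "continuous_on ({0..1::real} \<times> {0..}) (\<lambda>z. A (min 1 (2 * fst z)) (snd z))"
        by (rule continuous_on_compose2[OF contA, of _ "\<lambda>z. (min 1 (2 * fst z), snd z)", simplified])
          (auto intro!: continuous_intros)
      have 2: "continuous_on ({0..1::real} \<times> {0..}) (\<lambda>z. A 1 (snd z))"
        by (rule continuous_on_compose2[OF contA, of _ "\<lambda>z. (1, snd z)", simplified])
          (auto intro!: continuous_intros)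
      show ?thesis
        unfolding H_def case_prod_unfold by (intro continuous_intros 1 2)
    qed
    fix t :: real assume t: "0 \<le> t"
    show "H 0 t = f t" "H 1 t = a * of_real t"
      using t A_0 by (auto simp: H_def)
  next
    fix s :: real assume s: "s \<in> {0..1}"
    show "H s 0 = 0"
      using s N k0[of 1] k0[of "min 1 (2 * s)"] by (simp add: H_def A_early)
    have "H s t = f t + of_real (max 0 (2 * s - 1)) * (a * of_real t - f t)" if "N \<le> t" for t
      using s that A_late[of 1 t] A_late[of "min 1 (2 * s)" t] by (simp add: H_def)
    then have Re_H: "Re (H s t) = Re (f t) + max 0 (2 * s - 1) * (Re a * t - Re (f t))" if "N \<le> t" for t
      using that by simp
    have "filterlim (\<lambda>t. Re a * t) at_bot at_top"
      using \<open>Re a < 0\<close> by (intro filterlim_tendsto_neg_mult_at_bot[OF tendsto_const] filterlim_ident)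
    \<comment> \<open>For \<open>t \<ge> N\<close> the real part of \<open>H s t\<close> is a convex
      combination of \<open>Re (f t)\<close> and \<open>Re a * t\<close>, so their maximum dominates
      it.\<close>
    then have max: "filterlim (\<lambda>t. max (Re (f t)) (Re a * t)) at_bot at_top"
      using Re_at_bot by (auto simp: filterlim_at_bot eventually_conj_iff)
    show "filterlim (\<lambda>t. Re (H s t)) at_bot at_top"
    proof (rule filterlim_at_bot_mono[OF max])
      show "eventually (\<lambda>t. Re (H s t) \<le> max (Re (f t)) (Re a * t)) at_top"
        using eventually_ge_at_top[of N]
      proof eventually_elim
        case (elim t)
        define v where "v = max 0 (2 * s - 1)"
        have "Re (H s t) = (1 - v) * Re (f t) + v * (Re a * t)"
          using Re_H[OF elim] by (simp add: v_def algebra_simps)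
        also have "\<dots> \<le> max (Re (f t)) (Re a * t)"
          using s by (intro convex_bound_le) (auto simp: v_def)
        finally show ?case .
      qed
    qed
    fix t :: real assume t: "0 \<le> t"
    show "H s t \<notin> L"
    proof (cases "s \<le> 1 / 2")
      case True
      then show ?thesis
        using s t A_notin[of "2 * s" t] by (simp add: H_def)
    next
      case False
      define v where "v = 2 * s - 1"
      have v: "v \<in> {0..1}" and H: "H s t = A 1 t + of_real v * (a * of_real t - A 1 t)"
        using s False by (auto simp: v_def H_def)
      show ?thesis
      proof (cases "t \<le> N / 2")
        case True
        then show ?thesis
          using H A_1_early[of t] ray_notin[of "2 * x / N * t"] t x N by (simp add: a_t)
      next
        case False
        have "Re (a * of_real t) \<le> - x"
          using False N x by (simp add: a_t field_simps)
        moreover have "Re (H s t) = (1 - v) * Re (A 1 t) + v * Re (a * of_real t)"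
          unfolding H by (simp add: algebra_simps)
        ultimately have "Re (H s t) \<le> - x"
          using v A_1_late[of t] False by (simp add: convex_bound_le)
        then show ?thesis
          using x(2) by force
      qed
    qed
  qed
qed

end

section \<open>From paths in the plane to a one-dimensional space\<close>

context avoiding_path
begin

text \<open>The slope must separate the values \<open>Im l / (- Re l)\<close> of the two kinds of
  points, which \<open>slope_less\<close> puts in order. Columns unbounded in both directions make
  both sets nonempty.\<close>

lemma exists_separating_slope:
  assumes fin_Re: "finite (Re ` L)" and loc_fin: "\<And>r. finite {l \<in> L. norm l \<le> r}"
    and up: "\<And>l r. l \<in> L \<Longrightarrow> \<exists>k\<in>L. Re k = Re l \<and> r \<le> Im k"
    and down: "\<And>l r. l \<in> L \<Longrightarrow> \<exists>k\<in>L. Re k = Re l \<and> Im k \<le> r"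
  obtains \<sigma> where "\<And>l. \<lbrakk>l \<in> L; Re l < 0\<rbrakk> \<Longrightarrow>
      if passes_above l then Im l < \<sigma> * (- Re l) else \<sigma> * (- Re l) < Im l"
proof (cases "\<exists>l\<in>L. Re l < 0")
  case False
  then show thesis using that by blast
next
  case True
  then obtain m where m: "m \<in> L" "Re m < 0" by blast
  define S where "S = (\<lambda>l. Im l / (- Re l))"
  define A where "A = S ` {l \<in> L. Re l < 0 \<and> passes_above l}"
  define B where "B = S ` {l \<in> L. Re l < 0 \<and> \<not> passes_above l}"
  define d where "d = height (Re (f 0) + Re m) - height (Re (f 0))"
  have "A \<noteq> {}"
  proof -
    obtain k where "k \<in> L" "Re k = Re m" "Im k \<le> d - 1"
      using down[OF m(1)] by blast
    then have "k \<in> {l \<in> L. Re l < 0 \<and> passes_above l}"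
      using m(2) by (simp add: passes_above_def d_def)
    then show ?thesis
      unfolding A_def by blast
  qed
  moreover have "B \<noteq> {}"
  proof -
    obtain k where "k \<in> L" "Re k = Re m" "d \<le> Im k"
      using up[OF m(1)] by blast
    then have "k \<in> {l \<in> L. Re l < 0 \<and> \<not> passes_above l}"
      using m(2) by (simp add: passes_above_def d_def)
    then show ?thesis
      unfolding B_def by blast
  qed
  moreover have "a < b" if "a \<in> A" "b \<in> B" for a b
    using that slope_less unfolding A_def B_def S_def by blast
  moreover have "finite ((A \<union> B) \<inter> {u..v})" for u v
  proof -
    obtain M where M: "\<And>l. l \<in> L \<Longrightarrow> \<bar>Re l\<bar> \<le> M"
      using finite_imp_bounded[OF fin_Re] unfolding bounded_iff by (metis imageI real_norm_def)
    \<comment> \<open>Since \<open>Re l\<close> is bounded on \<open>L\<close>, a bound on the slope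
      bounds \<open>Im l\<close> as well, leaving only points of \<open>L\<close> in a disc.\<close>
    have "(A \<union> B) \<inter> {u..v} \<subseteq> S ` {l \<in> L. norm l \<le> M + M * (\<bar>u\<bar> + \<bar>v\<bar>)}"
    proof
      fix y assume y: "y \<in> (A \<union> B) \<inter> {u..v}"
      then obtain l where l: "y = S l" "l \<in> L" "Re l < 0"
        by (auto simp: A_def B_def)
      have "\<bar>Im l\<bar> = \<bar>Re l\<bar> * \<bar>y\<bar>"
        using l by (simp add: S_def abs_mult abs_divide)
      also have "\<dots> \<le> M * (\<bar>u\<bar> + \<bar>v\<bar>)"
        using M[OF l(2)] y by (intro mult_mono) auto
      finally have "norm l \<le> M + M * (\<bar>u\<bar> + \<bar>v\<bar>)"
        using M[OF l(2)] cmod_le[of l] by linarith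
      then show "y \<in> S ` {l \<in> L. norm l \<le> M + M * (\<bar>u\<bar> + \<bar>v\<bar>)}"
        using l by blast
    qed
    then show ?thesis
      using loc_fin finite_subset by blast
  qed
  ultimately obtain \<sigma> where s: "\<And>a. a \<in> A \<Longrightarrow> a < \<sigma>" "\<And>b. b \<in> B \<Longrightarrow> \<sigma> < b"
    using exists_between_locally_finite by metis
  show thesis
  proof (rule that[of \<sigma>])
    fix l assume l: "l \<in> L" "Re l < 0"
    show "if passes_above l then Im l < \<sigma> * (- Re l) else \<sigma> * (- Re l) < Im l"
    proof (cases "passes_above l")
      case True
      then have "S l < \<sigma>" using l by (intro s) (auto simp: A_def)
      then show ?thesis using True l unfolding S_def by (subst (asm) pos_divide_less_eq) auto
    next
      case False
      then have "\<sigma> < S l" using l by (intro s) (auto simp: B_def)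
      then show ?thesis using False l unfolding S_def by (subst (asm) pos_less_divide_eq) auto
    qed
  qed
qed

text \<open>For \<open>s \<le> 1 / 2\<close> the starting time slides from \<open>0\<close> to
  \<open>\<tau>\<close>, so all differences remain differences of points of the path; for larger
  \<open>s\<close> the restarted path is straightened.\<close>

lemma exponential_homotopy:
  assumes "closed L" and fin_Re: "finite (Re ` L)" and loc_fin: "\<And>r. finite {l \<in> L. norm l \<le> r}"
    and up: "\<And>l r. l \<in> L \<Longrightarrow> \<exists>k\<in>L. Re k = Re l \<and> r \<le> Im k"
    and down: "\<And>l r. l \<in> L \<Longrightarrow> \<exists>k\<in>L. Re k = Re l \<and> Im k \<le> r"
  obtains H :: "real \<Rightarrow> real \<Rightarrow> complex" and b a :: complex
  where "continuous_on ({0..1} \<times> {0..}) (\<lambda>(s, t). H s t)"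
    "\<And>s. s \<in> {0..1} \<Longrightarrow> filterlim (\<lambda>t. Re (H s t)) at_bot at_top"
    "\<And>t. 0 \<le> t \<Longrightarrow> H 0 t = f t" "\<And>t. 0 \<le> t \<Longrightarrow> H 1 t = b + a * of_real t"
    "\<And>s t. s \<in> {0..1} \<Longrightarrow> 0 \<le> t \<Longrightarrow> H s t - H s 0 \<notin> L"
proof -
  define \<tau> where "\<tau> = last_time (Re (f 0))"
  have \<tau>: "0 \<le> \<tau>" "Re (f \<tau>) = Re (f 0)"
    using last_time_nonneg Re_last_time by (simp_all add: \<tau>_def)
  define g where "g = (\<lambda>t. f (\<tau> + t) - f \<tau>)"
  have cont_shift: "continuous_on X (\<lambda>z. f (u z + v z))"
    if "continuous_on X u" "continuous_on X v" "\<And>z. z \<in> X \<Longrightarrow> 0 \<le> u z + v z"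
    for X :: "'z::topological_space set" and u v
    using that by (intro continuous_on_compose2[OF cont] continuous_intros) auto
  have add_at_bot: "filterlim (\<lambda>t. d + u t) at_bot at_top" if "filterlim u at_bot at_top"
    for d :: real and u :: "real \<Rightarrow> real"
  proof -
    have "eventually (\<lambda>t. u t \<le> Z - d) at_top" for Z
      using that by (simp add: filterlim_at_bot)
    then show ?thesis
      by (simp add: filterlim_at_bot algebra_simps)
  qed
  have lim_shift: "filterlim (\<lambda>t. Re (f (c + t)) + d) at_bot at_top" for c d
  proof -
    have "filterlim (\<lambda>t. c + t) at_top at_top"
      by (intro filterlim_tendsto_add_at_top[OF tendsto_const] filterlim_ident)
    then have "filterlim (\<lambda>t. Re (f (c + t))) at_bot at_top"
      by (rule filterlim_compose[OF Re_at_bot])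
    then have "filterlim (\<lambda>t. d + Re (f (c + t))) at_bot at_top"
      by (intro add_at_bot)
    then show ?thesis by (simp add: add.commute)
  qed
  interpret g: avoiding_path g L
  proof
    show "continuous_on {0..} g"
      unfolding g_def using \<tau> by (intro continuous_intros cont_shift) auto
    show "filterlim (\<lambda>t. Re (g t)) at_bot at_top"
      using lim_shift[of \<tau> "- Re (f \<tau>)"] by (simp add: g_def)
    show "g t - g s \<notin> L" if "0 \<le> s" "0 \<le> t" for s t
      using avoids[of "\<tau> + s" "\<tau> + t"] that \<tau> by (simp add: g_def)
  qed
  obtain \<sigma> where \<sigma>: "\<And>l. \<lbrakk>l \<in> L; Re l < 0\<rbrakk> \<Longrightarrow>
      if g.passes_above l then Im l < \<sigma> * (- Re l) else \<sigma> * (- Re l) < Im l"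
    using g.exists_separating_slope[OF fin_Re loc_fin up down] by blast
  interpret g: normalized_avoiding_path g L \<sigma>
  proof
    show "g 0 = 0" by (simp add: g_def)
    show "Re (g t) < 0" if "0 < t" for t
      using Re_after_last_time[of "Re (f 0)" "\<tau> + t"] that \<tau> by (simp add: g_def \<tau>_def)
    show "if g.passes_above l then Im l < \<sigma> * (- Re l) else \<sigma> * (- Re l) < Im l"
      if "l \<in> L" "Re l < 0" for l
      using that by (rule \<sigma>)
  qed (rule assms)+
  obtain H :: "real \<Rightarrow> real \<Rightarrow> complex" and a where H: "continuous_on ({0..1} \<times> {0..}) (\<lambda>(s, t). H s t)"
    "\<And>s. s \<in> {0..1} \<Longrightarrow> filterlim (\<lambda>t. Re (H s t)) at_bot at_top"
    "\<And>t. 0 \<le> t \<Longrightarrow> H 0 t = g t" "\<And>t. 0 \<le> t \<Longrightarrow> H 1 t = a * of_real t"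
    "\<And>s. s \<in> {0..1} \<Longrightarrow> H s 0 = 0"
    "\<And>s t. s \<in> {0..1} \<Longrightarrow> 0 \<le> t \<Longrightarrow> H s t \<notin> L"
    using g.ray_path_homotopy by blast
  \<comment> \<open>For \<open>s \<ge> 1 / 2\<close> the first term is
    \<open>f \<tau> + g t\<close>, and \<open>H 0 t = g t\<close> cancels, leaving
    \<open>f \<tau> + H (2 * s - 1) t\<close>.\<close>
  define G where "G = (\<lambda>s t. f (\<tau> * min 1 (2 * s) + t) + (H (max 0 (2 * s - 1)) t - H 0 t))"
  have G1: "G s t = f (\<tau> * (2 * s) + t)" if "s \<le> 1 / 2" for s t
    using that by (simp add: G_def)
  have G2: "G s t = f \<tau> + H (2 * s - 1) t" if "1 / 2 \<le> s" "0 \<le> t" for s t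
    using that H(3)[of t] by (simp add: G_def g_def)
  show thesis
  proof (rule that[of G "f \<tau>" a])
    have 1: "continuous_on ({0..1::real} \<times> {0..}) (\<lambda>z. H (max 0 (2 * fst z - 1)) (snd z))"
      by (rule continuous_on_compose2[OF H(1), of _ "\<lambda>z. (max 0 (2 * fst z - 1), snd z)", simplified])
        (auto intro!: continuous_intros)
    have 2: "continuous_on ({0..1::real} \<times> {0..}) (\<lambda>z. H 0 (snd z))"
      by (rule continuous_on_compose2[OF H(1), of _ "\<lambda>z. (0, snd z)", simplified])
        (auto intro!: continuous_intros)
    show "continuous_on ({0..1} \<times> {0..}) (\<lambda>(s, t). G s t)"
      unfolding G_def case_prod_unfold using \<tau>
      by (intro continuous_intros cont_shift 1 2) auto
    show "G 0 t = f t" "G 1 t = f \<tau> + a * of_real t" if "0 \<le> t" for t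
      using that G1[of 0 t] G2[of 1 t] H(4)[of t] by simp_all
    fix s :: real assume s: "s \<in> {0..1}"
    show "filterlim (\<lambda>t. Re (G s t)) at_bot at_top"
    proof (cases "s \<le> 1 / 2")
      case True
      then show ?thesis using lim_shift[of "\<tau> * (2 * s)" 0] by (simp add: G1)
    next
      case False
      then have "filterlim (\<lambda>t. Re (f \<tau>) + Re (H (2 * s - 1) t)) at_bot at_top"
        using s by (intro add_at_bot H) auto
      moreover have "eventually (\<lambda>t. Re (f \<tau>) + Re (H (2 * s - 1) t) = Re (G s t)) at_top"
        using eventually_ge_at_top[of 0] by eventually_elim (use False G2 in simp)
      ultimately show ?thesis
        by (rule iffD1[OF filterlim_cong[OF refl refl], rotated])
    qed
    fix t :: real assume t: "0 \<le> t"
    show "G s t - G s 0 \<notin> L"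
    proof (cases "s \<le> 1 / 2")
      case True
      then show ?thesis
        using s t \<tau> avoids[of "\<tau> * (2 * s)" "\<tau> * (2 * s) + t"] by (simp add: G1)
    next
      case False
      then show ?thesis
        using s t H(5)[of "2 * s - 1"] H(6)[of "2 * s - 1" t] by (simp add: G2)
    qed
  qed
qed

end

text \<open>Hausdorffness makes the complement of \<open>e\<close> an open neighbourhood of
  \<open>0\<close>. Continuity of \<open>scl\<close> at the origin then bounds \<open>\<phi>\<close>
  near \<open>0\<close>; scaling gives continuity at \<open>0\<close>, and additivity gives it
  everywhere.\<close>

lemma (in complex_hausdorff_tvs) continuous_on_coordinate:
  assumes \<phi>: "\<And>v. v = scl (\<phi> v) e" and "e \<noteq> 0"
  shows "continuous_on UNIV \<phi>"
proof -
  have eq: "\<phi> v = c" if "v = scl c e" for v c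
    using \<phi>[of v] that \<open>e \<noteq> 0\<close> by (metis scale_right_imp_eq)
  have \<phi>_scl: "\<phi> (scl c v) = c * \<phi> v" for c v
    by (rule eq) (metis \<phi> scale_scale)
  have \<phi>_diff: "\<phi> (v - w) = \<phi> v - \<phi> w" for v w
    by (rule eq) (metis \<phi> scale_left_diff_distrib)
  have tendsto_scl: "((\<lambda>v. scl c v) \<longlongrightarrow> 0) (nhds 0)" for c
  proof -
    have "continuous_on UNIV (\<lambda>v. scl c v)"
      using continuous_on_compose2[OF continuous_on_scl, of UNIV "\<lambda>v. (c, v)"]
      by (simp add: continuous_on_Pair)
    then have "isCont (\<lambda>v. scl c v) 0"
      by (simp add: continuous_on_eq_continuous_at)
    then show ?thesis
      using tendsto_at_iff_tendsto_nhds[of "\<lambda>v. scl c v" 0] by (simp add: isCont_def)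
  qed
  define W where "W = (\<lambda>(c, v). scl c v) -` (- {e})"
  have "open W"
    unfolding W_def by (intro open_vimage continuous_on_scl) auto
  moreover have "(0, 0) \<in> W"
    using \<open>e \<noteq> 0\<close> by (simp add: W_def)
  ultimately obtain D U where DU: "open D" "open U" "0 \<in> D" "0 \<in> U" "D \<times> U \<subseteq> W"
    by (auto elim!: open_prod_elim)
  obtain \<delta> where \<delta>: "\<delta> > 0" "ball 0 \<delta> \<subseteq> D"
    using DU by (meson openE)
  \<comment> \<open>A larger coordinate would make \<open>1 / \<phi> u\<close> a scalar in
    \<open>D\<close> that carries \<open>u\<close> to the excluded vector \<open>e\<close>.\<close>
  have bound: "norm (\<phi> u) \<le> 1 / \<delta>" if "u \<in> U" for u
  proof (rule ccontr)
    assume *: "\<not> ?thesis"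
    then have "\<phi> u \<noteq> 0" using \<delta> by auto
    have "1 / norm (\<phi> u) < \<delta>"
      using * \<delta> \<open>\<phi> u \<noteq> 0\<close> by (simp add: field_simps)
    then have "1 / \<phi> u \<in> D"
      using \<delta> by (auto simp: norm_divide)
    then have "scl (1 / \<phi> u) u \<noteq> e"
      using DU that by (auto simp: W_def)
    moreover have "scl (1 / \<phi> u) u = e"
      using \<phi>[of u] \<open>\<phi> u \<noteq> 0\<close> by (metis nonzero_eq_divide_eq scale_one scale_scale)
    ultimately show False by simp
  qed
  have lim: "(\<phi> \<longlongrightarrow> 0) (nhds 0)"
  proof (rule tendstoI)
    fix \<epsilon> :: real assume "\<epsilon> > 0"
    define c where "c = complex_of_real (2 / (\<delta> * \<epsilon>))"
    have c: "norm c = 2 / (\<delta> * \<epsilon>)"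
      using \<delta> \<open>\<epsilon> > 0\<close> by (simp add: c_def norm_divide norm_mult)
    have "eventually (\<lambda>v. scl c v \<in> U) (nhds 0)"
      using tendsto_scl DU(2,4) by (rule topological_tendstoD)
    then show "eventually (\<lambda>v. dist (\<phi> v) 0 < \<epsilon>) (nhds 0)"
    proof eventually_elim
      case (elim v)
      then have "norm c * norm (\<phi> v) \<le> 1 / \<delta>"
        using bound[of "scl c v"] by (simp add: \<phi>_scl norm_mult)
      then have "norm (\<phi> v) \<le> \<epsilon> / 2"
        using \<delta> \<open>\<epsilon> > 0\<close> by (simp add: c field_simps)
      then show ?case
        using \<open>\<epsilon> > 0\<close> by simp
    qed
  qed
  have "isCont \<phi> v" for v
  proof -
    have "((\<lambda>w. w - v) \<longlongrightarrow> v - v) (nhds v)"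
      by (intro tendsto_diff filterlim_ident tendsto_const)
    then have "((\<lambda>w. \<phi> (w - v)) \<longlongrightarrow> 0) (nhds v)"
      by (intro filterlim_compose[OF lim]) simp
    then have "((\<lambda>w. \<phi> (w - v) + \<phi> v) \<longlongrightarrow> 0 + \<phi> v) (nhds v)"
      by (intro tendsto_add tendsto_const)
    then have "(\<phi> \<longlongrightarrow> \<phi> v) (nhds v)"
      by (simp add: \<phi>_diff)
    then show ?thesis
      by (simp add: isCont_def tendsto_at_iff_tendsto_nhds)
  qed
  then show ?thesis
    by (simp add: continuous_at_imp_continuous_on)
qed

text \<open>Supplies the hypotheses of \<open>exponential_homotopy\<close>: columns sit at
  logarithms of moduli, zeros of \<open>exp z - c\<close> are finite in number on discs, and
  \<open>L\<close> is invariant under multiples of \<open>2 * pi * \<i>\<close>.\<close>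

lemma exp_vimage_properties:
  fixes \<Lambda> :: "complex set"
  assumes "finite \<Lambda>"
  defines "L \<equiv> exp -` \<Lambda>"
  shows "closed L" "finite (Re ` L)" "finite {l \<in> L. norm l \<le> r}"
    "l \<in> L \<Longrightarrow> \<exists>k\<in>L. Re k = Re l \<and> r \<le> Im k" "l \<in> L \<Longrightarrow> \<exists>k\<in>L. Re k = Re l \<and> Im k \<le> r"
proof -
  show "closed L"
    unfolding L_def using assms(1)
    by (intro closed_vimage finite_imp_closed continuous_on_exp continuous_on_id)
  have "Re ` L \<subseteq> (\<lambda>z. ln (norm z)) ` \<Lambda>"
  proof
    fix r assume "r \<in> Re ` L"
    then obtain l where "r = ln (norm (exp l))" "exp l \<in> \<Lambda>"
      by (auto simp: L_def)
    then show "r \<in> (\<lambda>z. ln (norm z)) ` \<Lambda>" by blast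
  qed
  then show "finite (Re ` L)"
    using assms(1) finite_subset by blast
  have nconst: "\<not> (\<lambda>z. exp z - c) constant_on (UNIV :: complex set)" for c
  proof
    assume "(\<lambda>z. exp z - c) constant_on UNIV"
    then have "exp 0 - c = exp (\<i> * pi) - c"
      unfolding constant_on_def by (metis UNIV_I)
    then show False by simp
  qed
  have "finite {z \<in> cball 0 r. exp z - c = 0}" for c :: complex
    by (rule holomorphic_compact_finite_zeros[where f = "\<lambda>z. exp z - c" and S = UNIV])
      (auto intro!: holomorphic_intros nconst)
  then have "finite (\<Union>c\<in>\<Lambda>. {z \<in> cball 0 r. exp z - c = 0})"
    using assms(1) by blast
  then show "finite {l \<in> L. norm l \<le> r}"
    by (rule rev_finite_subset) (auto simp: L_def)
  have shift: "l + of_int (2 * n) * pi * \<i> \<in> L" if "l \<in> L" for l n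
  proof -
    have "exp (of_int (2 * n) * pi * \<i> :: complex) = 1"
      by (simp add: exp_eq_1)
    then show ?thesis
      using that by (simp add: L_def exp_add)
  qed
  show "\<exists>k\<in>L. Re k = Re l \<and> r \<le> Im k" if "l \<in> L"
  proof -
    define n where "n = \<lceil>(r - Im l) / (2 * pi)\<rceil>"
    have "(r - Im l) / (2 * pi) \<le> of_int n"
      by (simp add: n_def)
    then show ?thesis
      using shift[OF that, of n]
      by (intro bexI[of _ "l + of_int (2 * n) * pi * \<i>"]) (auto simp: field_simps)
  qed
  show "\<exists>k\<in>L. Re k = Re l \<and> Im k \<le> r" if "l \<in> L"
  proof -
    define n where "n = \<lfloor>(r - Im l) / (2 * pi)\<rfloor>"
    have "of_int n \<le> (r - Im l) / (2 * pi)"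
      by (simp add: n_def)
    then show ?thesis
      using shift[OF that, of n]
      by (intro bexI[of _ "l + of_int (2 * n) * pi * \<i>"]) (auto simp: field_simps)
  qed
qed

theorem theorem2:
  fixes scl :: "complex \<Rightarrow> 'v::{topological_ab_group_add, t2_space} \<Rightarrow> 'v"
    and n :: nat
    and Rs :: "nat \<Rightarrow> ('v \<times> 'v) set"
    and R :: "('v \<times> 'v) set"
    and p :: "real \<Rightarrow> 'v"
  assumes "complex_hausdorff_tvs scl"
    and "vector_space.dim scl (UNIV :: 'v set) = 1"
    and "1 \<le> n"
    and "\<And>i. i \<in> {1..n} \<Longrightarrow> linear_relation scl (Rs i)"
    and "R = (\<Union>i\<in>{1..n}. Rs i)"
    and "sym R"
    and "relation_avoiding_origin_path R p"
  shows "\<exists>q. relation_avoiding_origin_path R q \<and> weakly_homotopic R p q \<and>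
    (\<exists>(k :: nat) (x :: nat \<Rightarrow> 'v) (a :: nat \<Rightarrow> complex).
      inj_on x {1..k} \<and> \<not> module.dependent scl (x ` {1..k}) \<and>
      (\<forall>t\<in>{0..}. q t = (\<Sum>j = 1..k. scl (exp (a j * of_real t)) (x j))))"
proof -
  interpret complex_hausdorff_tvs scl by fact
  interpret vector_space_prod scl scl ..
  have p: "continuous_on {0..} p" "(p \<longlongrightarrow> 0) at_top"
    "\<And>s t. 0 \<le> s \<Longrightarrow> 0 \<le> t \<Longrightarrow> (p s, p t) \<notin> R"
    using assms(7) by (auto simp: relation_avoiding_origin_path_def)
  have sub: "p.subspace (Rs i)" if "i \<in> {1..n}" for i
    using assms(4)[OF that] by (simp add: linear_relation_def)

  obtain B where B: "independent B" "UNIV \<subseteq> span B" "card B = 1"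
    using basis_exists[of UNIV] assms(2) by metis
  then obtain e where "B = {e}"
    by (auto simp: card_1_singleton_iff)
  with B have "e \<noteq> 0" "\<exists>c. v = scl c e" for v
    by (auto simp: span_singleton)
  then obtain \<phi> where \<phi>: "\<And>v. v = scl (\<phi> v) e"
    by metis
  have cont_\<phi>: "continuous_on UNIV \<phi>"
    by (rule continuous_on_coordinate[OF \<phi> \<open>e \<noteq> 0\<close>])
  have scl_eq: "scl c e = scl d e \<longleftrightarrow> c = d" for c d
    using \<open>e \<noteq> 0\<close> by (auto dest: scale_right_imp_eq)
  have "scl (\<phi> 0) e = scl 0 e"
    using \<phi>[of 0] by simp
  then have "\<phi> 0 = 0"
    by (simp only: scl_eq)

  define \<Lambda> where "\<Lambda> = {c. c \<noteq> 0 \<and> (e, scl c e) \<in> R}"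
  \<comment> \<open>A union of subspaces is closed under scaling, so for nonzero vectors the
    relation depends only on the ratio of coordinates.\<close>
  have R_iff: "(scl c e, scl d e) \<in> R \<longleftrightarrow> d / c \<in> \<Lambda>" if "c \<noteq> 0" "d \<noteq> 0" for c d
  proof -
    have scale: "(scl a v, scl a w) \<in> R" if vw: "(v, w) \<in> R" for a v w
    proof -
      obtain i where i: "i \<in> {1..n}" "(v, w) \<in> Rs i"
        using vw assms(5) by blast
      then have "scale a (v, w) \<in> Rs i"
        using p.subspace_scale[OF sub] by blast
      then show ?thesis
        using i assms(5) by (auto simp: scale_def)
    qed
    show ?thesis
      using scale[of "scl c e" "scl d e" "1 / c"] scale[of e "scl (d / c) e" c] that
      by (auto simp: \<Lambda>_def)
  qed
  have "p t \<noteq> 0" if t: "0 \<le> t" for t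
  proof
    assume "p t = 0"
    moreover have "0 \<in> Rs 1"
      using p.subspace_0[OF sub[of 1]] assms(3) by simp
    then have "(0, 0) \<in> R"
      using assms(3,5) by (auto simp: zero_prod_def)
    ultimately show False
      using p(3)[OF t t] by simp
  qed
  then have \<phi>p: "\<phi> (p t) \<noteq> 0" if "0 \<le> t" for t
    using \<phi>[of "p t"] that by force
  have ratio: "\<phi> (p t) / \<phi> (p s) \<notin> \<Lambda>" if "0 \<le> s" "0 \<le> t" for s t
    using R_iff[of "\<phi> (p s)" "\<phi> (p t)"] \<phi>p p(3)[of s t] that \<phi>[symmetric] by simp
  have "finite \<Lambda>"
  proof -
    have "finite {c. (e, scl c e) \<in> Rs i}" if i: "i \<in> {1..n}" for i
    proof -
      \<comment> \<open>Two distinct multiples would put \<open>(0, e)\<close> and then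
        \<open>(e, e)\<close> into \<open>Rs i\<close>. The ratio \<open>1\<close> would be
        forbidden, and \<open>p 0\<close> would be related to itself.\<close>
      have "c = d" if cd: "(e, scl c e) \<in> Rs i" "(e, scl d e) \<in> Rs i" for c d
      proof (rule ccontr)
        assume "c \<noteq> d"
        have "scale (1 / (c - d)) ((e, scl c e) - (e, scl d e)) \<in> Rs i"
          by (intro p.subspace_scale p.subspace_diff sub i cd)
        then have "(0, e) \<in> Rs i"
          using \<open>c \<noteq> d\<close> by (simp add: scale_def flip: scale_left_diff_distrib)
        then have "(e, scl c e) + scale (1 - c) (0, e) \<in> Rs i"
          by (intro p.subspace_add p.subspace_scale sub i cd)
        then have "(e, e) \<in> Rs i"
          by (simp add: scale_def flip: scale_left_distrib)
        then have "1 \<in> \<Lambda>"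
          using i assms(5) by (auto simp: \<Lambda>_def)
        then show False
          using ratio[of 0 0] \<phi>p[of 0] by simp
      qed
      then have "{c. (e, scl c e) \<in> Rs i} = {} \<or> (\<exists>c. {c. (e, scl c e) \<in> Rs i} = {c})"
        by blast
      then show ?thesis
        by auto
    qed
    then have "finite (\<Union>i\<in>{1..n}. {c. (e, scl c e) \<in> Rs i})"
      by blast
    then show ?thesis
      by (rule rev_finite_subset) (use assms(5) in \<open>auto simp: \<Lambda>_def\<close>)
  qed

  have cont_\<phi>p: "continuous_on {0..} (\<lambda>t. \<phi> (p t))"
    by (rule continuous_on_compose2[OF cont_\<phi> p(1)]) auto
  obtain f where f: "continuous_on {0..} f" "\<And>t. t \<in> {0..} \<Longrightarrow> \<phi> (p t) = exp (f t)"
    using continuous_logarithm_on_contractible[OF cont_\<phi>p convex_imp_contractible] \<phi>p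
    by (metis atLeast_iff convex_real_interval(1))
  define L where "L = exp -` \<Lambda>"
  interpret f: avoiding_path f L
  proof
    show "continuous_on {0..} f" by fact
    have "isCont \<phi> 0"
      using cont_\<phi> by (simp add: continuous_on_eq_continuous_at)
    then have "((\<lambda>t. \<phi> (p t)) \<longlongrightarrow> 0) at_top"
      using isCont_tendsto_compose[OF _ p(2), of \<phi>] \<open>\<phi> 0 = 0\<close> by simp
    then have "((\<lambda>t. norm (\<phi> (p t))) \<longlongrightarrow> 0) at_top"
      by (rule tendsto_norm_zero)
    moreover have "eventually (\<lambda>t. norm (\<phi> (p t)) > 0) at_top"
      using eventually_ge_at_top[of 0] by eventually_elim (simp add: \<phi>p)
    ultimately have "filterlim (\<lambda>t. norm (\<phi> (p t))) (at_right 0) at_top"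
      by (intro filterlim_at_withinI) auto
    then have "filterlim (\<lambda>t. ln (norm (\<phi> (p t)))) at_bot at_top"
      by (rule filterlim_compose[OF ln_at_0])
    moreover have "eventually (\<lambda>t. ln (norm (\<phi> (p t))) = Re (f t)) at_top"
      using eventually_ge_at_top[of 0] by eventually_elim (simp add: f(2))
    ultimately show "filterlim (\<lambda>t. Re (f t)) at_bot at_top"
      by (rule iffD1[OF filterlim_cong[OF refl refl], rotated])
    show "f t - f s \<notin> L" if "0 \<le> s" "0 \<le> t" for s t
      using ratio[OF that] that f(2)[of s] f(2)[of t] by (simp add: L_def exp_diff)
  qed
  note L = exp_vimage_properties[OF \<open>finite \<Lambda>\<close>, folded L_def]
  obtain H :: "real \<Rightarrow> real \<Rightarrow> complex" and b a where H: "continuous_on ({0..1} \<times> {0..}) (\<lambda>(s, t). H s t)"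
    "\<And>s. s \<in> {0..1} \<Longrightarrow> filterlim (\<lambda>t. Re (H s t)) at_bot at_top"
    "\<And>t. 0 \<le> t \<Longrightarrow> H 0 t = f t" "\<And>t. 0 \<le> t \<Longrightarrow> H 1 t = b + a * of_real t"
    "\<And>s t. s \<in> {0..1} \<Longrightarrow> 0 \<le> t \<Longrightarrow> H s t - H s 0 \<notin> L"
    using f.exponential_homotopy[OF L] by blast
  define h where "h = (\<lambda>s t. scl (exp (H s t)) e)"
  have sym_R: "(v, w) \<in> R \<longleftrightarrow> (w, v) \<in> R" for v w
    using assms(6) by (auto dest: symD)
  \<comment> \<open>The ratio criterion treats the pair with \<open>h s 0\<close> first; symmetry of
    \<open>R\<close> supplies the required order.\<close>
  have h_avoid: "(h s t, h s 0) \<notin> R" if "s \<in> {0..1}" "0 \<le> t" for s t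
    using H(5)[OF that] R_iff[of "exp (H s 0)" "exp (H s t)"] sym_R[of "h s t" "h s 0"]
    by (simp add: h_def L_def exp_diff)
  have cont_scl: "continuous_on UNIV (\<lambda>c. scl c e)"
    using continuous_on_compose2[OF continuous_on_scl, of UNIV "\<lambda>c. (c, e)"]
    by (simp add: continuous_on_Pair)
  have cont_h: "continuous_on ({0..1} \<times> {0..}) (\<lambda>(s, t). h s t)"
    using H(1) unfolding h_def case_prod_unfold
    by (intro continuous_on_compose2[OF cont_scl] continuous_intros) auto
  have lim_h: "(h s \<longlongrightarrow> 0) at_top" if "s \<in> {0..1}" for s
  proof -
    have "((\<lambda>t. exp (Re (H s t))) \<longlongrightarrow> 0) at_top"
      by (rule filterlim_compose[OF exp_at_bot H(2)[OF that]])
    then have "((\<lambda>t. exp (H s t)) \<longlongrightarrow> 0) at_top"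
      by (subst tendsto_norm_zero_iff[symmetric]) simp
    moreover have "isCont (\<lambda>c. scl c e) 0"
      using cont_scl by (simp add: continuous_on_eq_continuous_at)
    ultimately show ?thesis
      using isCont_tendsto_compose[of 0 "\<lambda>c. scl c e"] by (fastforce simp: h_def)
  qed
  show ?thesis
  \<comment> \<open>One vector suffices: \<open>exp (b + a * t)\<close> factors, and the constant
    \<open>exp b\<close> is absorbed into it.\<close>
  proof (intro exI[of _ "h 1"] exI[of _ 1] exI[of _ "\<lambda>_. scl (exp b) e"] exI[of _ "\<lambda>_. a"] conjI)
    show "weakly_homotopic R p (h 1)"
      unfolding weakly_homotopic_def
    proof (intro exI[of _ h] conjI)
      show "\<forall>t\<in>{0..}. h 0 t = p t"
        using H(3) f(2)[symmetric] \<phi>[symmetric] by (simp add: h_def)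
    qed (use cont_h lim_h h_avoid in auto)
    show "relation_avoiding_origin_path R (h 1)"
      unfolding relation_avoiding_origin_path_def
    proof (intro conjI notI)
      show "continuous_on {0..} (h 1)"
        by (rule continuous_on_compose2[OF cont_h, of _ "\<lambda>t. (1, t)", simplified])
          (auto intro!: continuous_intros)
      show "(h 1 \<longlongrightarrow> 0) at_top"
        by (rule lim_h) simp
      \<comment> \<open>The homotopy only compares with time \<open>0\<close>. As \<open>H 1\<close>
        is affine, its differences depend on \<open>t - s\<close> alone, which covers
        \<open>s \<le> t\<close>; symmetry covers the rest.\<close>
      have forward: "(h 1 s, h 1 t) \<notin> R" if "0 \<le> s" "s \<le> t" for s t
      proof -
        have "H 1 t - H 1 s = H 1 (t - s) - H 1 0"
          using that by (simp add: H(4) algebra_simps)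
        then have "exp (H 1 t - H 1 s) \<notin> \<Lambda>"
          using H(5)[of 1 "t - s"] that by (simp add: L_def)
        then show ?thesis
          using R_iff[of "exp (H 1 s)" "exp (H 1 t)"] by (simp add: h_def exp_diff)
      qed
      assume "\<exists>t1\<in>{0..}. \<exists>t2\<in>{0..}. (h 1 t1, h 1 t2) \<in> R"
      then obtain s t where "0 \<le> s" "0 \<le> t" "(h 1 s, h 1 t) \<in> R"
        by auto
      then show False
        using forward[of s t] forward[of t s] sym_R[of "h 1 s" "h 1 t"] by linarith
    qed
    show "\<not> dependent ((\<lambda>_. scl (exp b) e) ` {1..1::nat})"
      using \<open>e \<noteq> 0\<close> by simp
    show "\<forall>t\<in>{0..}. h 1 t = (\<Sum>j = 1..1::nat. scl (exp (a * of_real t)) (scl (exp b) e))"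
      using H(4) by (simp add: h_def exp_add mult.commute)
  qed simp
qed

end
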